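(* Let $X$ be a Banach space and let $T : X \to X$ be a compact linear operator, with adjoint $T^{*} : X^{*} \to X^{*}$. Then $a_n(T) = a_n(T^{*})$ for all $n$.
   Context: For Banach spaces $X, Y$, $\mathcal{L}(X,Y)$ denotes the normed space of all continuous linear operators from $X$ to $Y$, and $\mathcal{F}_n(X,Y) = \{A \in \mathcal{L}(X,Y) : \operatorname{rank}(A) \le n\}$. The $n$th approximation number of $T \in \mathcal{L}(X,Y)$ is $$a_n(T) = \inf\{\|T - A\| : A \in \mathcal{F}_n(X,Y)\}, \quad n = 0,1,\dots$$ $X^{*}$ denotes the dual space of $X$, and $T^{*}$ the adjoint operator of $T$; the approximation numbers of $T^{*}$ are computed in $\mathcal{L}(X^{*},X^{*})$. *)

theory Defs
  imports "HOL-Analysis.Analysis"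
begin

section \<open>The scalar field\<close>

text \<open>
  HOL-Analysis only knows Banach spaces over the reals. To treat real and complex spaces
  uniformly, scalars are taken from a normed field that is either the reals or the complex
  numbers. In the second alternative \<open>i\<close> plays the role of the imaginary unit.
\<close>

class real_or_complex = real_normed_field +
  assumes real_or_complex:
    "(\<forall>z. \<exists>a. z = a *\<^sub>R 1) \<or>
     (\<exists>i. i * i = - 1 \<and>
        (\<forall>z. \<exists>a b. z = a *\<^sub>R 1 + b *\<^sub>R i) \<and>
        (\<forall>a b. norm (a *\<^sub>R 1 + b *\<^sub>R i) = sqrt (a\<^sup>2 + b\<^sup>2)))"

instance real :: real_or_complex
  by standard auto

instance complex :: real_or_complex
proof
  have "\<exists>a b. z = a *\<^sub>R 1 + b *\<^sub>R \<i>" for z :: complex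
    by (intro exI[of _ "Re z"] exI[of _ "Im z"]) (simp add: complex_eq_iff)
  moreover have "norm (a *\<^sub>R 1 + b *\<^sub>R \<i>) = sqrt (a\<^sup>2 + b\<^sup>2)" for a b
    by (simp add: cmod_def)
  ultimately show "(\<forall>z::complex. \<exists>a. z = a *\<^sub>R 1) \<or>
     (\<exists>i::complex. i * i = - 1 \<and>
        (\<forall>z. \<exists>a b. z = a *\<^sub>R 1 + b *\<^sub>R i) \<and>
        (\<forall>a b. norm (a *\<^sub>R 1 + b *\<^sub>R i) = sqrt (a\<^sup>2 + b\<^sup>2)))"
    by (intro disjI2 exI[of _ \<i>]) auto
qed


section \<open>Normed spaces over the scalar field\<close>

text \<open>
  The norm and the addition come from the type; completeness is expressed by the type class
  \<^class>\<open>banach\<close>. The first axiom only says that the real scalar multiplication supplied by the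
  type is the restriction of \<open>scale\<close>, so it is no constraint on the space.
\<close>

locale normed_space_over = vector_space scale
  for scale :: "'k::real_or_complex \<Rightarrow> 'a::real_normed_vector \<Rightarrow> 'a" +
  assumes scale_of_real: "scale (of_real r) x = r *\<^sub>R x"
    and norm_scale: "norm (scale c x) = norm c * norm x"

lemma normed_space_over_scaleR:
  "normed_space_over (scaleR :: real \<Rightarrow> 'a::real_normed_vector \<Rightarrow> 'a)"
  by unfold_locales (auto simp: algebra_simps)

lemma normed_space_over_times:
  "normed_space_over ((*) :: 'k::real_or_complex \<Rightarrow> 'k \<Rightarrow> 'k)"
  by unfold_locales (auto simp: algebra_simps norm_mult scaleR_conv_of_real)


section \<open>Operators and approximation numbers\<close>

text \<open>
  A space is given by a carrier \<open>V\<close>, which is a subspace of a type, together with its scalar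
  multiplication \<open>s\<close>. Carriers are needed because the dual space is a proper subspace of a type
  in the complex case. The values of an operator outside the carrier are irrelevant.
\<close>

definition continuous_operators ::
  "'a::real_normed_vector set \<Rightarrow> ('k::real_or_complex \<Rightarrow> 'a \<Rightarrow> 'a) \<Rightarrow>
   'b::real_normed_vector set \<Rightarrow> ('k \<Rightarrow> 'b \<Rightarrow> 'b) \<Rightarrow> ('a \<Rightarrow> 'b) set" where
  "continuous_operators V s W t =
     {A. (\<forall>x\<in>V. A x \<in> W) \<and>
         (\<forall>x\<in>V. \<forall>y\<in>V. A (x + y) = A x + A y) \<and>
         (\<forall>c. \<forall>x\<in>V. A (s c x) = t c (A x)) \<and>
         continuous_on V A}"

definition operator_norm :: "'a::real_normed_vector set \<Rightarrow> ('a \<Rightarrow> 'b::real_normed_vector) \<Rightarrow> real"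
  where "operator_norm V A = (SUP x\<in>{x\<in>V. norm x \<le> 1}. norm (A x))"

text \<open>
  The first conjunct, finite-dimensionality of the range, is not redundant: the library sets the
  dimension of an infinite-dimensional space to 0.
\<close>

definition rank_at_most ::
  "'a set \<Rightarrow> ('k::field \<Rightarrow> 'b::ab_group_add \<Rightarrow> 'b) \<Rightarrow> nat \<Rightarrow> ('a \<Rightarrow> 'b) \<Rightarrow> bool" where
  "rank_at_most V t n A \<longleftrightarrow>
     (\<exists>B. finite B \<and> A ` V \<subseteq> module.span t B) \<and> vector_space.dim t (A ` V) \<le> n"

definition approximation_number ::
  "'a::real_normed_vector set \<Rightarrow> ('k::real_or_complex \<Rightarrow> 'a \<Rightarrow> 'a) \<Rightarrow>
   'b::real_normed_vector set \<Rightarrow> ('k \<Rightarrow> 'b \<Rightarrow> 'b) \<Rightarrow> nat \<Rightarrow> ('a \<Rightarrow> 'b) \<Rightarrow> real" where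
  "approximation_number V s W t n T =
     Inf {operator_norm V (\<lambda>x. T x - A x) | A.
            A \<in> continuous_operators V s W t \<and> rank_at_most V t n A}"

definition compact_operator ::
  "('k::real_or_complex \<Rightarrow> 'a::real_normed_vector \<Rightarrow> 'a) \<Rightarrow>
   ('k \<Rightarrow> 'b::real_normed_vector \<Rightarrow> 'b) \<Rightarrow> ('a \<Rightarrow> 'b) \<Rightarrow> bool" where
  "compact_operator s t T \<longleftrightarrow>
     Vector_Spaces.linear s t T \<and> (\<forall>S. bounded S \<longrightarrow> compact (closure (T ` S)))"


section \<open>Dual space and adjoint\<close>

text \<open>
  Continuous functionals are bounded real-linear maps into the scalars that are moreover
  compatible with \<open>s\<close>; they carry the operator norm of the type \<open>'a \<Rightarrow>\<^sub>L 'k\<close>.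
\<close>

definition dual_space ::
  "('k::real_or_complex \<Rightarrow> 'a::real_normed_vector \<Rightarrow> 'a) \<Rightarrow> ('a \<Rightarrow>\<^sub>L 'k) set" where
  "dual_space s = {f. \<forall>c x. blinfun_apply f (s c x) = c * blinfun_apply f x}"

definition dual_scale ::
  "'k::real_or_complex \<Rightarrow> ('a::real_normed_vector \<Rightarrow>\<^sub>L 'k) \<Rightarrow> ('a \<Rightarrow>\<^sub>L 'k)" where
  "dual_scale c f = blinfun_mult_right c o\<^sub>L f"

text \<open>Only meaningful for bounded linear \<open>T\<close>, because of the abstraction function.\<close>

definition adjoint_operator ::
  "('a::real_normed_vector \<Rightarrow> 'b::real_normed_vector) \<Rightarrow>
   ('b \<Rightarrow>\<^sub>L 'k::real_or_complex) \<Rightarrow> ('a \<Rightarrow>\<^sub>L 'k)" where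
  "adjoint_operator T f = Blinfun (\<lambda>x. blinfun_apply f (T x))"

lemma dual_scale_apply [simp]: "blinfun_apply (dual_scale c f) x = c * blinfun_apply f x"
  by (simp add: dual_scale_def)

lemma norm_dual_scale: "norm (dual_scale c f) = norm c * norm f"
proof -
  have le: "norm (dual_scale c f) \<le> norm c * norm f"
    for c :: "'k::real_or_complex" and f :: "'a::real_normed_vector \<Rightarrow>\<^sub>L 'k"
  proof (rule norm_blinfun_bound)
    show "norm (blinfun_apply (dual_scale c f) x) \<le> norm c * norm f * norm x" for x
      using norm_blinfun[of f x]
      by (simp add: norm_mult mult.assoc mult_left_mono)
  qed simp
  show ?thesis
  proof (cases "c = 0")
    case True
    then show ?thesis using le[of c f] by simp
  next
    case False
    then have "f = dual_scale (inverse c) (dual_scale c f)"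
      by (intro blinfun_eqI) simp
    then have "norm f \<le> inverse (norm c) * norm (dual_scale c f)"
      using le by (metis norm_inverse)
    from mult_left_mono[OF this norm_ge_zero[of c]]
    have "norm c * norm f \<le> norm (dual_scale c f)"
      using False by (simp flip: mult.assoc)
    then show ?thesis using le[of c f] by simp
  qed
qed

lemma normed_space_over_dual_scale:
  "normed_space_over
     (dual_scale :: 'k::real_or_complex \<Rightarrow> ('a::real_normed_vector \<Rightarrow>\<^sub>L 'k) \<Rightarrow> ('a \<Rightarrow>\<^sub>L 'k))"
  by unfold_locales
    (auto intro!: blinfun_eqI
      simp: algebra_simps blinfun.bilinear_simps norm_dual_scale scaleR_conv_of_real)

lemma subspace_dual_space:
  fixes s :: "'k::real_or_complex \<Rightarrow> 'a::real_normed_vector \<Rightarrow> 'a"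
  shows "module.subspace dual_scale (dual_space s)"
proof -
  interpret D: normed_space_over
    "dual_scale :: 'k \<Rightarrow> ('a \<Rightarrow>\<^sub>L 'k) \<Rightarrow> ('a \<Rightarrow>\<^sub>L 'k)"
    by (rule normed_space_over_dual_scale)
  show ?thesis
    unfolding D.subspace_def dual_space_def
    by (auto simp: algebra_simps blinfun.bilinear_simps)
qed

lemma dual_space_scaleR: "dual_space (scaleR :: real \<Rightarrow> 'a::real_normed_vector \<Rightarrow> 'a) = UNIV"
  by (auto simp: dual_space_def blinfun.bilinear_simps)

lemma compact_operator_bounded_linear:
  assumes "normed_space_over s" "normed_space_over t" "compact_operator s t T"
  shows "bounded_linear T"
proof -
  interpret S: normed_space_over s by fact
  interpret R: normed_space_over t by fact
  interpret T: Vector_Spaces.linear s t T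
    using assms(3) by (simp add: compact_operator_def)
  have lin: "linear T"
    by (rule linearI) (auto simp: T.add T.scale simp flip: S.scale_of_real R.scale_of_real)
  have "bounded (closure (T ` cball 0 1))"
    using assms(3) by (auto simp: compact_operator_def intro: compact_imp_bounded)
  then obtain M where M: "\<And>x. norm x \<le> 1 \<Longrightarrow> norm (T x) \<le> M"
    using closure_subset[of "T ` cball 0 1"] by (force simp: bounded_iff)
  show ?thesis
  proof (rule bounded_linear_intro[where K = M])
    fix x
    show "norm (T x) \<le> norm x * M"
    proof (cases "x = 0")
      case False
      have "norm (T (x /\<^sub>R norm x)) \<le> M"
        by (rule M) (simp add: False)
      then show ?thesis
        using False by (simp add: linear_scale[OF lin] field_simps)
    qed (simp add: linear_0[OF lin])
  qed (auto simp: linear_add[OF lin] linear_scale[OF lin])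
qed

lemma adjoint_operator_apply:
  "bounded_linear T \<Longrightarrow>
     blinfun_apply (adjoint_operator T f) x = blinfun_apply f (T x)"
  unfolding adjoint_operator_def
  by (simp add: bounded_linear_Blinfun_apply bounded_linear_compose[OF blinfun.bounded_linear_right])

end

theory Submission
  imports Defs "HOL-Library.Function_Algebras"
begin

text \<open>
  One inequality holds for every continuous operator: if \<open>A\<close> has rank at most \<open>n\<close>, so does its
  adjoint, and the adjoint of \<open>T - A\<close> has at most the norm of \<open>T - A\<close>
  (\<open>approximation_number_adjoint_le\<close>).

  For the other inequality let \<open>B\<close> be an operator of rank at most \<open>n\<close> between the dual spaces. In
  general it is not an adjoint: \<open>B f = \<Sum>h. \<phi> h f * h\<close> for finitely many functionals \<open>h\<close>, but the
  coefficients \<open>\<phi> h\<close> belong to the bidual of the target space, and an approximant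
  \<open>A x = \<Sum>h. h x * z h\<close> of \<open>T\<close> needs vectors \<open>z h\<close> of the space itself. Two facts overcome this.

  \<^item> As long as only finitely many points \<open>x\<close> of the unit ball are tested, the \<open>\<phi> h\<close> can be replaced
    by vectors \<open>z h\<close> at an arbitrarily small cost in \<open>norm (T x - A x)\<close>. This is a consequence of
    the Hahn-Banach theorem in a finite power of the space
    (\<open>finite_preadjoint_approximation\<close>); it takes the place of the principle of local
    reflexivity.

  \<^item> Because \<open>T\<close> is compact, finitely many points suffice: there is a finite net in the unit ball for
    \<open>T\<close> and the functionals \<open>h\<close> simultaneously (\<open>compact_operator_finite_net\<close>), and the norms of the
    \<open>z h\<close> can be bounded before the net is chosen (\<open>approximation_number_le_adjoint\<close>).

  The argument works for compact operators between two different normed spaces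
  (\<open>approximation_number_adjoint\<close>). The Hahn-Banach theorem is proved from Zorn's lemma, applied to
  the sublinear functionals below a given one.
\<close>

section \<open>Sublinear functionals and the Hahn-Banach theorem\<close>

definition sublinear :: "(real \<Rightarrow> 'v \<Rightarrow> 'v) \<Rightarrow> ('v::ab_group_add \<Rightarrow> real) \<Rightarrow> bool" where
  "sublinear s p \<longleftrightarrow>
     (\<forall>u v. p (u + v) \<le> p u + p v) \<and> (\<forall>r u. 0 \<le> r \<longrightarrow> p (s r u) = r * p u)"

lemma sublinearI:
  fixes s :: "real \<Rightarrow> 'v::ab_group_add \<Rightarrow> 'v"
  assumes "vector_space s"
    and add: "\<And>u v. p (u + v) \<le> p u + p v"
    and scale: "\<And>r u. 0 < r \<Longrightarrow> p (s r u) \<le> r * p u"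
    and zero: "p 0 = 0"
  shows "sublinear s p"
proof -
  interpret vector_space s by fact
  have "p (s r u) = r * p u" if "0 \<le> r" for r u
  proof (cases "r = 0")
    case False
    then have r: "0 < r" using that by simp
    have "p u = p (s (inverse r) (s r u))" using r by simp
    also have "\<dots> \<le> inverse r * p (s r u)" using r by (intro scale) simp
    finally have "r * p u \<le> p (s r u)" using r by (simp add: field_simps)
    then show ?thesis using scale[OF r, of u] by simp
  qed (simp add: zero)
  then show ?thesis using add by (auto simp: sublinear_def)
qed

lemma sublinear_add: "sublinear s p \<Longrightarrow> p (u + v) \<le> p u + p v"
  by (simp add: sublinear_def)

lemma sublinear_scale: "sublinear s p \<Longrightarrow> 0 \<le> r \<Longrightarrow> p (s r u) = r * p u"
  by (simp add: sublinear_def)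

lemma sublinear_0:
  assumes "vector_space s" "sublinear s p"
  shows "p 0 = 0"
proof -
  interpret vector_space s by fact
  show ?thesis using sublinear_scale[OF assms(2), of 0 0] by simp
qed

lemma sublinear_minus_le:
  assumes "vector_space s" "sublinear s p"
  shows "- p (- u) \<le> p u"
  using sublinear_add[OF assms(2), of u "- u"] sublinear_0[OF assms] by simp

text \<open>
  The infimum subtracts from \<open>p\<close> as much as possible along the ray through \<open>w\<close>. It is finite because
  \<open>t * p w = p (t w) \<le> p (u + t w) + p (- u)\<close>, and \<open>t = 1\<close> at \<open>u = - w\<close> gives the last property. If
  \<open>p\<close> is minimal, the result is \<open>p\<close> again, which forces \<open>p (- w) = - p w\<close>; for a general \<open>p\<close>, every
  linear functional below the result takes the value \<open>p w\<close> at \<open>w\<close>.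
\<close>

lemma sublinear_tilt:
  fixes s :: "real \<Rightarrow> 'v::ab_group_add \<Rightarrow> 'v"
  assumes vs: "vector_space s" and p: "sublinear s p"
  obtains q where "sublinear s q" "\<And>u. q u \<le> p u" "q (- w) \<le> - p w"
proof
  interpret vector_space s by fact
  define q where "q u = (INF t\<in>{0..}. p (u + s t w) - t * p w)" for u
  have low: "- p (- u) \<le> p (u + s t w) - t * p w" if "0 \<le> t" for u t
    using sublinear_add[OF p, of "u + s t w" "- u"] sublinear_scale[OF p that, of w] by simp
  have bdd: "bdd_below ((\<lambda>t. p (u + s t w) - t * p w) ` {0..})" for u
    using low by (intro bdd_belowI2[where m = "- p (- u)"]) auto
  have le: "q u \<le> p (u + s t w) - t * p w" if "0 \<le> t" for u t
    unfolding q_def using that by (intro cINF_lower[OF bdd]) auto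
  have greatest: "c \<le> q u" if "\<And>t. 0 \<le> t \<Longrightarrow> c \<le> p (u + s t w) - t * p w" for c u
    unfolding q_def using that by (intro cINF_greatest) auto
  show "sublinear s q"
  proof (rule sublinearI[OF vs])
    fix u v
    have "q (u + v) - q v \<le> q u"
    proof (rule greatest)
      fix t :: real assume t: "0 \<le> t"
      have "q (u + v) - (p (u + s t w) - t * p w) \<le> q v"
      proof (rule greatest)
        fix t' :: real assume t': "0 \<le> t'"
        have "q (u + v) \<le> p (u + v + s (t + t') w) - (t + t') * p w"
          using t t' by (intro le) simp
        also have "u + v + s (t + t') w = (u + s t w) + (v + s t' w)"
          by (simp add: scale_left_distrib)
        also have "p \<dots> \<le> p (u + s t w) + p (v + s t' w)"
          by (rule sublinear_add[OF p])
        finally show "q (u + v) - (p (u + s t w) - t * p w) \<le> p (v + s t' w) - t' * p w"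
          by (simp add: algebra_simps)
      qed
      then show "q (u + v) - q v \<le> p (u + s t w) - t * p w" by simp
    qed
    then show "q (u + v) \<le> q u + q v" by simp
  next
    fix r :: real and u assume r: "0 < r"
    have "q (s r u) / r \<le> q u"
    proof (rule greatest)
      fix t :: real assume t: "0 \<le> t"
      have "q (s r u) \<le> p (s r u + s (r * t) w) - (r * t) * p w"
        using r t by (intro le) simp
      also have "s r u + s (r * t) w = s r (u + s t w)"
        by (simp add: scale_right_distrib)
      also have "p \<dots> = r * p (u + s t w)"
        using r by (intro sublinear_scale[OF p]) simp
      finally show "q (s r u) / r \<le> p (u + s t w) - t * p w"
        using r by (simp add: field_simps)
    qed
    then show "q (s r u) \<le> r * q u" using r by (simp add: field_simps)
  next
    have "q 0 \<le> 0" using le[of 0 0] sublinear_0[OF vs p] by simp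
    moreover have "0 \<le> q 0" using low[of _ 0] sublinear_0[OF vs p] by (intro greatest) simp
    ultimately show "q 0 = 0" by simp
  qed
  show "q u \<le> p u" for u using le[of 0 u] by simp
  show "q (- w) \<le> - p w" using le[of 1 "- w"] sublinear_0[OF vs p] by simp
qed

text \<open>
  The lower bounds that Zorn's lemma asks for. The common upper bound \<open>p\<close> makes the infimum finite,
  because \<open>q u \<ge> - q (- u) \<ge> - p (- u)\<close>. An infimum of sublinear functionals need not be
  subadditive in general; here two members are comparable, so the smaller one can be used at both
  arguments.
\<close>

lemma sublinear_INF_chain:
  fixes s :: "real \<Rightarrow> 'v::ab_group_add \<Rightarrow> 'v"
  assumes vs: "vector_space s" and "C \<noteq> {}"
    and C: "\<And>q. q \<in> C \<Longrightarrow> sublinear s q" "\<And>q u. q \<in> C \<Longrightarrow> q u \<le> p u"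
    and chain: "\<And>q q'. q \<in> C \<Longrightarrow> q' \<in> C \<Longrightarrow> (\<forall>u. q u \<le> q' u) \<or> (\<forall>u. q' u \<le> q u)"
  obtains q where "sublinear s q" "\<And>q' u. q' \<in> C \<Longrightarrow> q u \<le> q' u"
proof
  define m where "m u = (INF q\<in>C. q u)" for u
  have "- p (- u) \<le> q u" if "q \<in> C" for q u
    using sublinear_minus_le[OF vs C(1)[OF that], of u] C(2)[OF that, of "- u"] by linarith
  then have bdd: "bdd_below ((\<lambda>q. q u) ` C)" for u
    by (intro bdd_belowI2[where m = "- p (- u)"]) auto
  show le: "m u \<le> q u" if "q \<in> C" for q u
    unfolding m_def using that by (intro cINF_lower[OF bdd]) auto
  have greatest: "c \<le> m u" if "\<And>q. q \<in> C \<Longrightarrow> c \<le> q u" for c u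
    unfolding m_def using that \<open>C \<noteq> {}\<close> by (intro cINF_greatest) auto
  show "sublinear s m"
  proof (rule sublinearI[OF vs])
    fix u v
    have "m (u + v) - m v \<le> m u"
    proof (rule greatest)
      fix q assume q: "q \<in> C"
      have "m (u + v) - q u \<le> m v"
      proof (rule greatest)
        fix q' assume q': "q' \<in> C"
        from chain[OF q q'] show "m (u + v) - q u \<le> q' v"
        proof
          assume *: "\<forall>u. q u \<le> q' u"
          have "m (u + v) \<le> q u + q v"
            using le[OF q] sublinear_add[OF C(1)[OF q]] order_trans by blast
          then show ?thesis using *[rule_format, of v] by simp
        next
          assume *: "\<forall>u. q' u \<le> q u"
          have "m (u + v) \<le> q' u + q' v"
            using le[OF q'] sublinear_add[OF C(1)[OF q']] order_trans by blast
          then show ?thesis using *[rule_format, of u] by simp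
        qed
      qed
      then show "m (u + v) - m v \<le> q u" by simp
    qed
    then show "m (u + v) \<le> m u + m v" by simp
  next
    fix r :: real and u assume r: "0 < r"
    have "m (s r u) / r \<le> m u"
    proof (rule greatest)
      fix q assume q: "q \<in> C"
      have "m (s r u) \<le> r * q u"
        using le[OF q, of "s r u"] sublinear_scale[OF C(1)[OF q], of r u] r by simp
      then show "m (s r u) / r \<le> q u" using r by (simp add: field_simps)
    qed
    then show "m (s r u) \<le> r * m u" using r by (simp add: field_simps)
  next
    have "(\<lambda>q. q 0) ` C = (\<lambda>q. 0) ` C"
      using sublinear_0[OF vs C(1)] by (intro image_cong) auto
    then show "m 0 = 0" using \<open>C \<noteq> {}\<close> by (simp add: m_def image_constant_conv)
  qed
qed

text \<open>
  Minimal sublinear functionals are linear: tilting cannot make them smaller, so they are odd, and an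
  odd subadditive functional is additive. Starting Zorn's lemma below the tilt of \<open>p\<close> along \<open>w\<close>,
  rather than below \<open>p\<close> itself, secures the value at \<open>w\<close>, so that no extension from a subspace has
  to be carried out.
\<close>

lemma hahn_banach:
  fixes s :: "real \<Rightarrow> 'v::ab_group_add \<Rightarrow> 'v"
  assumes vs: "vector_space s" and p: "sublinear s p"
  obtains F where "Vector_Spaces.linear s (*) F" "\<And>u. F u \<le> p u" "F w = p w"
proof -
  interpret vector_space s by fact
  \<comment> \<open>Every linear functional below \<open>p0\<close> takes at least the value \<open>p w\<close> at \<open>w\<close>.\<close>
  obtain p0 where p0: "sublinear s p0" "\<And>u. p0 u \<le> p u" "p0 (- w) \<le> - p w"
    using sublinear_tilt[OF vs p] by metis
  define Q where "Q = {q. sublinear s q \<and> (\<forall>u. q u \<le> p0 u)}"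
  \<comment> \<open>The order is reversed because Zorn's lemma is stated for maximal elements.\<close>
  define below where "below q q' \<longleftrightarrow> (\<forall>u. q' u \<le> q u)" for q q' :: "'v \<Rightarrow> real"
  have "\<exists>F\<in>Q. \<forall>q\<in>Q. below F q \<longrightarrow> q = F"
  proof (rule predicate_Zorn)
    show "partial_order_on Q (relation_of below Q)"
      by (rule partial_order_on_relation_ofI)
        (auto simp: below_def fun_eq_iff intro: order_trans intro!: antisym)
    fix C assume "C \<in> Chains (relation_of below Q)"
    then have CQ: "C \<subseteq> Q" and chain: "\<And>q q'. q \<in> C \<Longrightarrow> q' \<in> C \<Longrightarrow> below q q' \<or> below q' q"
      by (auto simp: Chains_def relation_of_def)
    show "\<exists>q\<in>Q. \<forall>q'\<in>C. below q' q"
    proof (cases "C = {}")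
      case True
      then show ?thesis using p0 by (auto simp: Q_def)
    next
      case False
      have C: "sublinear s q" "q u \<le> p0 u" if "q \<in> C" for q u
        using CQ that by (auto simp: Q_def)
      obtain q where q: "sublinear s q" "\<And>q' u. q' \<in> C \<Longrightarrow> q u \<le> q' u"
      proof (rule sublinear_INF_chain[OF vs False])
        show "sublinear s q" "q u \<le> p0 u" if "q \<in> C" for q u using C[OF that] .
        show "(\<forall>u. q u \<le> q' u) \<or> (\<forall>u. q' u \<le> q u)" if "q \<in> C" "q' \<in> C" for q q'
          using chain[OF that] by (auto simp: below_def)
      qed (rule that)
      obtain q0 where "q0 \<in> C" using False by blast
      then have "q u \<le> p0 u" for u
        using q(2)[of q0 u] C(2)[of q0 u] by linarith
      then show ?thesis using q by (auto simp: Q_def below_def)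
    qed
  qed
  then obtain F where "F \<in> Q" and F_min: "\<And>q. q \<in> Q \<Longrightarrow> below F q \<Longrightarrow> q = F"
    by blast
  then have F: "sublinear s F" "\<And>u. F u \<le> p0 u" by (auto simp: Q_def)
  have min: "q = F" if "sublinear s q" "\<And>u. q u \<le> F u" for q
  proof (rule F_min)
    have "q u \<le> p0 u" for u using that(2)[of u] F(2)[of u] by linarith
    then show "q \<in> Q" using that(1) by (simp add: Q_def)
    show "below F q" using that(2) by (simp add: below_def)
  qed
  have minus: "F (- u) = - F u" for u
  proof -
    obtain q where "sublinear s q" "\<And>v. q v \<le> F v" "q (- u) \<le> - F u"
      using sublinear_tilt[OF vs F(1)] by metis
    then have "F (- u) \<le> - F u" using min by metis
    then show ?thesis using sublinear_minus_le[OF vs F(1), of u] by simp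
  qed
  have add: "F (u + v) = F u + F v" for u v
  proof (rule antisym)
    have "F (- u + - v) \<le> F (- u) + F (- v)" by (rule sublinear_add[OF F(1)])
    moreover have "F (- u + - v) = - F (u + v)" using minus[of "u + v"] by simp
    ultimately show "F u + F v \<le> F (u + v)" by (simp add: minus)
  qed (rule sublinear_add[OF F(1)])
  have scale: "F (s r u) = r * F u" for r u
  proof (cases "0 \<le> r")
    case True
    then show ?thesis by (rule sublinear_scale[OF F(1)])
  next
    case False
    then have "F (s (- r) u) = - r * F u" by (intro sublinear_scale[OF F(1)]) simp
    then show ?thesis using minus[of "s r u"] by simp
  qed
  show ?thesis
  proof (rule that)
    show "Vector_Spaces.linear s (*) F"
      unfolding Vector_Spaces.linear_iff
      using add scale vs vector_space_over_itself.vector_space_axioms by blast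
    show "F u \<le> p u" for u using F(2) p0(2) order_trans by blast
    have "- F w \<le> - p w" using F(2)[of "- w"] p0(3) minus[of w] by simp
    then show "F w = p w" using \<open>F w \<le> p w\<close> by simp
  qed
qed

text \<open>
  The separation of a point from a subspace, obtained from the quotient seminorm
  \<open>u \<mapsto> inf {N (u - z) | z \<in> Z}\<close>. This functional vanishes on \<open>Z\<close>, hence so does every linear
  functional below it.
\<close>

lemma hahn_banach_distance:
  fixes s :: "real \<Rightarrow> 'v::ab_group_add \<Rightarrow> 'v"
  assumes vs: "vector_space s" and N: "sublinear s N" "\<And>u. 0 \<le> N u"
    and Z: "module.subspace s Z"
    and far: "\<And>z. z \<in> Z \<Longrightarrow> c \<le> N (w - z)"
  obtains F where "Vector_Spaces.linear s (*) F" "\<And>u. F u \<le> N u"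
    "\<And>z. z \<in> Z \<Longrightarrow> F z = 0" "c \<le> F w"
proof -
  interpret vector_space s by fact
  define p where "p u = (INF z\<in>Z. N (u - z))" for u
  have Z0: "0 \<in> Z" by (rule subspace_0[OF Z])
  have bdd: "bdd_below ((\<lambda>z. N (u - z)) ` Z)" for u
    using N(2) by (intro bdd_belowI2[where m = 0]) auto
  have le: "p u \<le> N (u - z)" if "z \<in> Z" for u z
    unfolding p_def using that by (intro cINF_lower[OF bdd]) auto
  have greatest: "c \<le> p u" if "\<And>z. z \<in> Z \<Longrightarrow> c \<le> N (u - z)" for c u
    unfolding p_def using that Z0 by (intro cINF_greatest) auto
  have pZ: "p z \<le> 0" if "z \<in> Z" for z
    using le[OF that, of z] sublinear_0[OF vs N(1)] by simp
  have "sublinear s p"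
  proof (rule sublinearI[OF vs])
    fix u v
    have "p (u + v) - p v \<le> p u"
    proof (rule greatest)
      fix z assume z: "z \<in> Z"
      have "p (u + v) - N (u - z) \<le> p v"
      proof (rule greatest)
        fix z' assume z': "z' \<in> Z"
        have "p (u + v) \<le> N ((u + v) - (z + z'))"
          by (intro le subspace_add[OF Z] z z')
        also have "(u + v) - (z + z') = (u - z) + (v - z')" by simp
        also have "N \<dots> \<le> N (u - z) + N (v - z')" by (rule sublinear_add[OF N(1)])
        finally show "p (u + v) - N (u - z) \<le> N (v - z')" by simp
      qed
      then show "p (u + v) - p v \<le> N (u - z)" by simp
    qed
    then show "p (u + v) \<le> p u + p v" by simp
  next
    fix r :: real and u assume r: "0 < r"
    have "p (s r u) / r \<le> p u"
    proof (rule greatest)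
      fix z assume z: "z \<in> Z"
      have "p (s r u) \<le> N (s r u - s r z)" by (intro le subspace_scale[OF Z] z)
      also have "s r u - s r z = s r (u - z)" by (simp add: scale_right_diff_distrib)
      also have "N \<dots> = r * N (u - z)" using r by (intro sublinear_scale[OF N(1)]) simp
      finally show "p (s r u) / r \<le> N (u - z)" using r by (simp add: field_simps)
    qed
    then show "p (s r u) \<le> r * p u" using r by (simp add: field_simps)
  next
    show "p 0 = 0" using pZ[OF Z0] N(2) by (intro antisym greatest) auto
  qed
  from hahn_banach[OF vs this] obtain F
    where F: "Vector_Spaces.linear s (*) F" "\<And>u. F u \<le> p u" "F w = p w" by metis
  interpret F: Vector_Spaces.linear s "(*)" F by fact
  show ?thesis
  proof (rule that)
    show "Vector_Spaces.linear s (*) F" by fact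
    show "F u \<le> N u" for u using F(2)[of u] le[OF Z0, of u] by simp
    show "F z = 0" if "z \<in> Z" for z
      using F(2)[of z] F(2)[of "- z"] pZ[OF that] pZ[OF subspace_neg[OF Z that]] F.neg[of z] by simp
    show "c \<le> F w" unfolding F(3) by (rule greatest[OF far])
  qed
qed

section \<open>Real and complex scalars\<close>

lemma scalar_cases:
  obtains (real) "\<And>z::'k::real_or_complex. \<exists>a. z = of_real a"
  | (complex) i :: "'k::real_or_complex" where "i * i = - 1"
      "\<And>z. \<exists>a b. z = of_real a + of_real b * i"
      "\<And>a b. norm (of_real a + of_real b * i) = sqrt (a\<^sup>2 + b\<^sup>2)"
  using real_or_complex[where 'a = 'k] by (auto simp: scaleR_conv_of_real)

lemma compact_cball_scalar: "compact (cball (0::'k::real_or_complex) r)"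
proof (cases rule: scalar_cases[where 'k = 'k])
  case real
  have "cball (0::'k) r \<subseteq> of_real ` {- r..r}"
  proof
    fix z :: 'k assume z: "z \<in> cball 0 r"
    obtain a where "z = of_real a" using real by blast
    with z show "z \<in> of_real ` {- r..r}" by (intro image_eqI[of _ _ a]) auto
  qed
  moreover have "compact (of_real ` {- r..r} :: 'k set)"
    by (intro compact_continuous_image continuous_intros compact_Icc)
  ultimately show ?thesis using compact_Int_closed[OF _ closed_cball] by (metis inf.absorb2)
next
  case (complex i)
  let ?\<phi> = "\<lambda>(a, b). of_real a + of_real b * i"
  have "cball 0 r \<subseteq> ?\<phi> ` ({- r..r} \<times> {- r..r})"
  proof
    fix z :: 'k assume z: "z \<in> cball 0 r"
    obtain a b where ab: "z = of_real a + of_real b * i" using complex(2) by blast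
    have "sqrt (a\<^sup>2 + b\<^sup>2) \<le> r" using z complex(3)[of a b] by (simp add: ab)
    moreover have "sqrt (a\<^sup>2) \<le> sqrt (a\<^sup>2 + b\<^sup>2)" "sqrt (b\<^sup>2) \<le> sqrt (a\<^sup>2 + b\<^sup>2)" by simp_all
    ultimately have "\<bar>a\<bar> \<le> r" "\<bar>b\<bar> \<le> r" unfolding real_sqrt_abs by linarith+
    then have "(a, b) \<in> {- r..r} \<times> {- r..r}" by auto
    then show "z \<in> ?\<phi> ` ({- r..r} \<times> {- r..r})" unfolding ab by force
  qed
  moreover have "compact (?\<phi> ` ({- r..r} \<times> {- r..r}))"
    unfolding case_prod_beta
    by (intro compact_continuous_image continuous_intros compact_Times compact_Icc)
  ultimately show ?thesis using compact_Int_closed[OF _ closed_cball] by (metis inf.absorb2)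
qed

text \<open>
  Reduction of complex functionals to real ones. With \<open>\<rho>\<close> the real part, a real-linear \<open>f\<close> is the
  real part of the scalar-linear functional \<open>x \<mapsto> f x - f (i x) i\<close>; over the reals, \<open>\<rho>\<close> is the
  identification of \<open>'k\<close> with the reals.
\<close>

lemma real_part_of_functionals:
  fixes s :: "'k::real_or_complex \<Rightarrow> 'a::real_normed_vector \<Rightarrow> 'a"
  assumes "normed_space_over s"
  obtains \<rho> :: "'k \<Rightarrow> real" where "linear \<rho>" "\<And>r. \<rho> (of_real r) = r" "\<And>z. \<bar>\<rho> z\<bar> \<le> norm z"
    "\<And>f. bounded_linear f \<Longrightarrow> \<exists>h\<in>dual_space s. \<forall>x. \<rho> (blinfun_apply h x) = f x"
proof -
  interpret normed_space_over s by fact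
  have Blinfun: "blinfun_apply (Blinfun g) = g" if "bounded_linear g" for g :: "'a \<Rightarrow> 'k"
    using that by (rule bounded_linear_Blinfun_apply)
  show ?thesis
  proof (cases rule: scalar_cases[where 'k = 'k])
    case real
    then obtain \<rho> :: "'k \<Rightarrow> real" where \<rho>: "\<And>z. z = of_real (\<rho> z)" by metis
    show ?thesis
    proof (rule that[of \<rho>])
      show [simp]: "\<rho> (of_real r) = r" for r using \<rho>[of "of_real r"] by simp
      show "linear \<rho>"
      proof (rule linearI)
        show "\<rho> (z + z') = \<rho> z + \<rho> z'" for z z'
          using \<rho>[of z] \<rho>[of z'] \<rho>[of "z + z'"] by (metis of_real_add of_real_eq_iff)
        show "\<rho> (r *\<^sub>R z) = r *\<^sub>R \<rho> z" for r z
          using \<rho>[of z] \<rho>[of "r *\<^sub>R z"]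
          by (metis of_real_eq_iff of_real_mult real_scaleR_def scaleR_conv_of_real)
      qed
      show "\<bar>\<rho> z\<bar> \<le> norm z" for z using \<rho>[of z] norm_of_real[of "\<rho> z", where 'a='k] by simp
      fix f :: "'a \<Rightarrow> real" assume f: "bounded_linear f"
      then interpret f: bounded_linear f .
      let ?h = "\<lambda>x. of_real (f x) :: 'k"
      have bl: "bounded_linear ?h"
        by (rule bounded_linear_compose[OF bounded_linear_of_real f])
      have "?h (s c x) = c * ?h x" for c x
        using \<rho>[of c] scale_of_real[of "\<rho> c" x] by (metis f.scaleR of_real_mult real_scaleR_def)
      then show "\<exists>h\<in>dual_space s. \<forall>x. \<rho> (blinfun_apply h x) = f x"
        by (intro bexI[of _ "Blinfun ?h"]) (auto simp: dual_space_def Blinfun[OF bl])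
    qed
  next
    case (complex i)
    obtain re im :: "'k \<Rightarrow> real" where z: "\<And>z. z = of_real (re z) + of_real (im z) * i"
      using complex(2) by metis
    have eq0: "a = 0 \<and> b = 0" if "of_real a + of_real b * i = 0" for a b
      using complex(3)[of a b] that by simp
    have uniq: "re w = a" if "w = of_real a + of_real b * i" for w a b
      using eq0[of "re w - a" "im w - b"] z[of w] that by (simp add: algebra_simps)
    show ?thesis
    proof (rule that[of re])
      show "re (of_real r) = r" for r using uniq[of "of_real r" r 0] by simp
      show "linear re"
      proof (rule linearI)
        show "re (w + w') = re w + re w'" for w w'
        proof (rule uniq)
          have "of_real (re w + re w') + of_real (im w + im w') * i =
              (of_real (re w) + of_real (im w) * i) + (of_real (re w') + of_real (im w') * i)"
            by (simp add: algebra_simps)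
          then show "w + w' = of_real (re w + re w') + of_real (im w + im w') * i"
            by (simp flip: z)
        qed
        show "re (r *\<^sub>R w) = r *\<^sub>R re w" for r w
        proof (rule uniq)
          have "of_real (r *\<^sub>R re w) + of_real (r * im w) * i =
              r *\<^sub>R (of_real (re w) + of_real (im w) * i)"
            by (simp add: scaleR_conv_of_real algebra_simps)
          then show "r *\<^sub>R w = of_real (r *\<^sub>R re w) + of_real (r * im w) * i"
            by (simp flip: z)
        qed
      qed
      show "\<bar>re w\<bar> \<le> norm w" for w
      proof -
        have "sqrt ((re w)\<^sup>2) \<le> sqrt ((re w)\<^sup>2 + (im w)\<^sup>2)" by simp
        also have "\<dots> = norm w" using complex(3)[of "re w" "im w"] by (simp flip: z)
        finally show ?thesis by simp
      qed
      fix f :: "'a \<Rightarrow> real" assume f: "bounded_linear f"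
      then interpret f: bounded_linear f .
      let ?h = "\<lambda>x. of_real (f x) - of_real (f (s i x)) * i"
      have si: "bounded_linear (s i)"
        by (rule bounded_linear_intro[of _ "norm i"])
          (auto simp: scale_right_distrib norm_scale mult_ac simp flip: scale_of_real)
      have fs: "bounded_linear (\<lambda>x. f (s i x))" by (rule bounded_linear_compose[OF f si])
      have bl: "bounded_linear ?h"
        by (intro bounded_linear_sub bounded_linear_compose[OF bounded_linear_of_real]
            bounded_linear_compose[OF bounded_linear_mult_left] f fs)
      have "?h (s c x) = c * ?h x" for c x
      proof -
        have scx: "s c x = re c *\<^sub>R x + im c *\<^sub>R s i x"
          using z[of c] by (metis scale_left_distrib scale_of_real scale_scale)
        have "s i (s c x) = re c *\<^sub>R s i x + im c *\<^sub>R s (i * i) x"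
          unfolding scx by (simp add: scale_right_distrib mult_ac flip: scale_of_real)
        then have sicx: "s i (s c x) = re c *\<^sub>R s i x - im c *\<^sub>R x" by (simp add: complex(1))
        have ii: "i * (i * w) = - w" for w by (simp add: complex(1) flip: mult.assoc)
        have "?h (s c x) = of_real (re c * f x + im c * f (s i x))
            - of_real (re c * f (s i x) - im c * f x) * i"
          unfolding sicx unfolding scx by (simp add: f.add f.diff f.scaleR)
        also have "\<dots> = (of_real (re c) + of_real (im c) * i) * ?h x"
          by (simp add: algebra_simps ii)
        finally show ?thesis using z[of c] by simp
      qed
      moreover have "re (?h x) = f x" for x by (rule uniq[of _ _ "- f (s i x)"]) simp
      ultimately show "\<exists>h\<in>dual_space s. \<forall>x. re (blinfun_apply h x) = f x"
        by (intro bexI[of _ "Blinfun ?h"]) (auto simp: dual_space_def Blinfun[OF bl])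
    qed
  qed
qed

section \<open>Rank and biorthogonal vectors\<close>

text \<open>
  This form is transferred to the adjoint more easily than the definition: a bound on the size of
  independent sets gives the finite spanning set and the dimension at once.
\<close>

lemma rank_at_most_iff:
  assumes "vector_space t"
  shows "rank_at_most V t n A \<longleftrightarrow>
    (\<forall>B\<subseteq>A ` V. finite B \<longrightarrow> \<not> module.dependent t B \<longrightarrow> card B \<le> n)"
proof -
  interpret vector_space t by fact
  show ?thesis
  proof
    assume "rank_at_most V t n A"
    then obtain B0 where B0: "finite B0" "A ` V \<subseteq> span B0" "dim (A ` V) \<le> n"
      by (auto simp: rank_at_most_def)
    obtain C where C: "C \<subseteq> A ` V" "independent C" "A ` V \<subseteq> span C" "card C = dim (A ` V)"
      by (rule basis_exists)
    have "finite C" using independent_span_bound[OF B0(1) C(2)] B0(2) C(1) by blast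
    then show "\<forall>B\<subseteq>A ` V. finite B \<longrightarrow> independent B \<longrightarrow> card B \<le> n"
      using independent_span_bound[of C] C(3,4) B0(3) by fastforce
  next
    assume le: "\<forall>B\<subseteq>A ` V. finite B \<longrightarrow> independent B \<longrightarrow> card B \<le> n"
    obtain C where C: "C \<subseteq> A ` V" "independent C" "A ` V \<subseteq> span C"
      by (rule maximal_independent_subset)
    have "finite C"
    proof (rule ccontr)
      assume "infinite C"
      then obtain B where B: "B \<subseteq> C" "finite B" "card B = Suc n"
        using infinite_arbitrarily_large by blast
      then have "card B \<le> n" using le C(1) independent_mono[OF C(2)] by blast
      then show False using B by simp
    qed
    moreover from this have "card C \<le> n" using le C(1,2) by blast
    then have "dim (A ` V) \<le> n" using dim_le_card[OF C(3) \<open>finite C\<close>] by linarith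
    ultimately show "rank_at_most V t n A"
      using C(3) unfolding rank_at_most_def by blast
  qed
qed

text \<open>
  By induction on \<open>H\<close>. Subtracting from \<open>x\<close> its expansion along the vectors found so far gives a
  vector \<open>P x\<close> on which the functionals in \<open>H\<close> vanish. If the new functional \<open>f\<close> vanished on all
  \<open>P x\<close> as well, it would be a combination of \<open>H\<close>. So some \<open>P x\<close> can be normalised to a
  partner of \<open>f\<close>, and the earlier vectors are corrected by multiples of it.
\<close>

lemma biorthogonal_vectors:
  fixes s :: "'k::real_or_complex \<Rightarrow> 'a::real_normed_vector \<Rightarrow> 'a"
  assumes "normed_space_over s" "finite H" "H \<subseteq> dual_space s" "\<not> module.dependent dual_scale H"
  obtains e where
    "\<And>g h. g \<in> H \<Longrightarrow> h \<in> H \<Longrightarrow> blinfun_apply g (e h) = (if g = h then 1 else 0)"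
proof -
  interpret X: normed_space_over s by fact
  interpret D: normed_space_over "dual_scale :: 'k \<Rightarrow> ('a \<Rightarrow>\<^sub>L 'k) \<Rightarrow> ('a \<Rightarrow>\<^sub>L 'k)"
    by (rule normed_space_over_dual_scale)
  have "\<exists>e. \<forall>g\<in>H. \<forall>h\<in>H. blinfun_apply g (e h) = (if g = h then 1 else 0)"
    using assms(2-4)
  proof (induction H rule: finite_induct)
    case (insert f H)
    have "D.independent H"
      using insert.prems(2) by (rule D.independent_mono) auto
    then obtain e where e: "\<And>g h. g \<in> H \<Longrightarrow> h \<in> H \<Longrightarrow> blinfun_apply g (e h) = (if g = h then 1 else 0)"
      using insert.IH insert.prems(1) by blast
    have scale: "blinfun_apply g (s c x) = c * blinfun_apply g x" if "g \<in> insert f H" for g c x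
      using that insert.prems(1) by (auto simp: dual_space_def)
    define P where "P x = x - (\<Sum>h\<in>H. s (blinfun_apply h x) (e h))" for x
    have gP: "blinfun_apply g (P x) = blinfun_apply g x - (\<Sum>h\<in>H. blinfun_apply h x * blinfun_apply g (e h))"
      if "g \<in> insert f H" for g x
      using scale[OF that] by (simp add: P_def blinfun.diff_right blinfun.sum_right)
    have P0: "blinfun_apply g (P x) = 0" if "g \<in> H" for g x
      using that insert.hyps(1) by (simp add: gP e if_distrib cong: if_cong)
    have "\<exists>x. blinfun_apply f (P x) \<noteq> 0"
    proof (rule ccontr)
      assume *: "\<not> ?thesis"
      have "f = (\<Sum>h\<in>H. dual_scale (blinfun_apply f (e h)) h)"
      proof (rule blinfun_eqI)
        fix x
        have "blinfun_apply f x = (\<Sum>h\<in>H. blinfun_apply h x * blinfun_apply f (e h))"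
          using gP[of f x] * by auto
        then show "blinfun_apply f x = blinfun_apply (\<Sum>h\<in>H. dual_scale (blinfun_apply f (e h)) h) x"
          by (simp add: blinfun.sum_left mult.commute)
      qed
      moreover have "(\<Sum>h\<in>H. dual_scale (blinfun_apply f (e h)) h) \<in> D.span H"
        by (intro D.span_sum D.span_scale D.span_base)
      ultimately have "f \<in> D.span H" by simp
      then show False using insert.prems(2) insert.hyps(2) by (simp add: D.independent_insert)
    qed
    then obtain x where x: "blinfun_apply f (P x) \<noteq> 0" by blast
    define d where "d = s (inverse (blinfun_apply f (P x))) (P x)"
    have fd: "blinfun_apply f d = 1" using x by (simp add: d_def scale)
    have gd: "blinfun_apply g d = 0" if "g \<in> H" for g using that by (simp add: d_def scale P0)
    define e' where "e' h = (if h = f then d else e h - s (blinfun_apply f (e h)) d)" for h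
    have "blinfun_apply g (e' h) = (if g = h then 1 else 0)" if "g \<in> insert f H" "h \<in> insert f H" for g h
      using that insert.hyps(2) by (auto simp: e'_def fd gd e scale blinfun.diff_right)
    then show ?case by blast
  qed simp
  then show ?thesis using that by blast
qed

section \<open>Operator norms and approximation numbers on subspaces\<close>

text \<open>
  Both sides of the theorem are approximation numbers, one for operators on whole types and one for
  operators between dual spaces, which are subspaces of a type. The locale covers both.
\<close>

locale operator_spaces =
  dom: normed_space_over s + cod: normed_space_over t
  for s :: "'k::real_or_complex \<Rightarrow> 'a::real_normed_vector \<Rightarrow> 'a"
    and t :: "'k \<Rightarrow> 'b::real_normed_vector \<Rightarrow> 'b" +
  fixes V :: "'a set" and W :: "'b set"
  assumes subspace_V: "dom.subspace V" and subspace_W: "cod.subspace W"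
begin

abbreviation operators :: "('a \<Rightarrow> 'b) set" where
  "operators \<equiv> continuous_operators V s W t"

lemma operator_0: "A \<in> operators \<Longrightarrow> A 0 = 0"
  using dom.subspace_0[OF subspace_V]
  by (auto simp: continuous_operators_def dest!: spec[of _ 0] bspec[of _ _ 0])

lemma operator_sum:
  assumes A: "A \<in> operators" and "\<And>i. i \<in> I \<Longrightarrow> f i \<in> V"
  shows "A (\<Sum>i\<in>I. s (c i) (f i)) = (\<Sum>i\<in>I. t (c i) (A (f i)))"
  using assms(2)
proof (induction I rule: infinite_finite_induct)
  case (insert i I)
  have "(\<Sum>i\<in>I. s (c i) (f i)) \<in> V" "s (c i) (f i) \<in> V"
    using insert.prems by (auto intro!: dom.subspace_sum dom.subspace_scale subspace_V)
  then show ?case using A insert by (simp add: continuous_operators_def)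
qed (simp_all add: operator_0[OF A])

lemma zero_operator: "(\<lambda>_. 0) \<in> operators"
  using cod.subspace_0[OF subspace_W] by (simp add: continuous_operators_def)

lemma diff_operator:
  assumes "A \<in> operators" "B \<in> operators"
  shows "(\<lambda>x. A x - B x) \<in> operators"
  using assms cod.subspace_diff[OF subspace_W]
  by (auto simp: continuous_operators_def cod.scale_right_diff_distrib intro!: continuous_intros)

lemma operator_bounded:
  assumes A: "A \<in> operators"
  obtains K where "0 \<le> K" "\<And>x. x \<in> V \<Longrightarrow> norm (A x) \<le> K * norm x"
proof -
  have "continuous_on V A" using A by (simp add: continuous_operators_def)
  then have "\<exists>d>0. \<forall>x\<in>V. dist x 0 < d \<longrightarrow> dist (A x) (A 0) < 1"
    using dom.subspace_0[OF subspace_V] unfolding continuous_on_iff by (meson zero_less_one)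
  then obtain d where d: "d > 0" "\<And>x. x \<in> V \<Longrightarrow> norm x < d \<Longrightarrow> norm (A x) < 1"
    by (auto simp: operator_0[OF A])
  have "norm (A x) \<le> 2 / d * norm x" if x: "x \<in> V" for x
  proof (cases "x = 0")
    case False
    define r where "r = d / (2 * norm x)"
    have r: "r > 0" using False d(1) by (simp add: r_def)
    have "norm (s (of_real r) x) < d" unfolding dom.scale_of_real using False d(1) by (simp add: r_def)
    then have "norm (A (s (of_real r) x)) < 1" by (intro d(2) dom.subspace_scale[OF subspace_V x])
    also have "A (s (of_real r) x) = r *\<^sub>R A x"
      using A x by (simp add: continuous_operators_def cod.scale_of_real)
    finally show ?thesis using r False d(1) by (simp add: r_def field_simps)
  qed (simp add: operator_0[OF A])
  moreover have "0 \<le> 2 / d" using d(1) by simp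
  ultimately show thesis using that by blast
qed

lemma bdd_above_operator:
  assumes A: "A \<in> operators"
  shows "bdd_above ((\<lambda>x. norm (A x)) ` {x\<in>V. norm x \<le> 1})"
proof -
  obtain K where K: "0 \<le> K" "\<And>x. x \<in> V \<Longrightarrow> norm (A x) \<le> K * norm x"
    using operator_bounded[OF A] by metis
  show ?thesis
  proof (rule bdd_aboveI2)
    fix x assume "x \<in> {x\<in>V. norm x \<le> 1}"
    then show "norm (A x) \<le> K"
      using K(2)[of x] mult_left_mono[OF _ K(1), of "norm x" 1] by simp
  qed
qed

lemma operator_norm_le:
  assumes "\<And>x. x \<in> V \<Longrightarrow> norm x \<le> 1 \<Longrightarrow> norm (A x) \<le> c"
  shows "operator_norm V A \<le> c"
  unfolding operator_norm_def
  using assms dom.subspace_0[OF subspace_V] by (intro cSUP_least) auto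

lemma norm_operator_le:
  assumes A: "A \<in> operators" and x: "x \<in> V"
  shows "norm (A x) \<le> operator_norm V A * norm x"
proof (cases "x = 0")
  case False
  define r where "r = inverse (norm x)"
  have r: "r > 0" using False by (simp add: r_def)
  have "s (of_real r) x \<in> {x\<in>V. norm x \<le> 1}"
    using dom.subspace_scale[OF subspace_V x, of "of_real r"] False unfolding dom.scale_of_real by (simp add: r_def)
  then have "norm (A (s (of_real r) x)) \<le> operator_norm V A"
    unfolding operator_norm_def by (rule cSUP_upper[OF _ bdd_above_operator[OF A]])
  also have "A (s (of_real r) x) = r *\<^sub>R A x"
    using A x by (simp add: continuous_operators_def cod.scale_of_real)
  finally show ?thesis using r False by (simp add: r_def field_simps)
qed (simp add: operator_0[OF A])

lemma operator_norm_nonneg: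
  assumes A: "A \<in> operators"
  shows "0 \<le> operator_norm V A"
  using cSUP_upper[OF _ bdd_above_operator[OF A], of 0] dom.subspace_0[OF subspace_V]
  by (simp add: operator_norm_def operator_0[OF A])

lemma approximation_number_le:
  assumes T: "T \<in> operators" and A: "A \<in> operators" "rank_at_most V t n A"
  shows "approximation_number V s W t n T \<le> operator_norm V (\<lambda>x. T x - A x)"
  unfolding approximation_number_def
proof (rule cInf_lower)
  show "bdd_below {operator_norm V (\<lambda>x. T x - A x) |A. A \<in> operators \<and> rank_at_most V t n A}"
    using operator_norm_nonneg[OF diff_operator[OF T]] by (intro bdd_belowI[of _ 0]) auto
qed (use A in blast)

lemma approximation_number_greatest:
  assumes "\<And>A. A \<in> operators \<Longrightarrow> rank_at_most V t n A \<Longrightarrow> c \<le> operator_norm V (\<lambda>x. T x - A x)"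
  shows "c \<le> approximation_number V s W t n T"
  unfolding approximation_number_def
proof (rule cInf_greatest)
  have "(\<lambda>_. 0) ` V \<subseteq> cod.span {}" by auto
  then have "rank_at_most V t n (\<lambda>_. 0)"
    using cod.dim_le_card[of "(\<lambda>_. 0) ` V" "{}"] unfolding rank_at_most_def by force
  then show "{operator_norm V (\<lambda>x. T x - A x) |A. A \<in> operators \<and> rank_at_most V t n A} \<noteq> {}"
    using zero_operator by blast
qed (use assms in blast)

end

lemma operator_spaces_UNIV:
  assumes "normed_space_over s" "normed_space_over t"
  shows "operator_spaces s t UNIV UNIV"
proof -
  interpret dom: normed_space_over s by fact
  interpret cod: normed_space_over t by fact
  show ?thesis by unfold_locales (rule dom.subspace_UNIV cod.subspace_UNIV)+
qed

lemma operator_spaces_dual: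
  "operator_spaces dual_scale dual_scale (dual_space s) (dual_space t)"
  by (simp add: operator_spaces_def operator_spaces_axioms_def normed_space_over_dual_scale
      subspace_dual_space)

section \<open>Approximating the adjoint\<close>

lemma continuous_operators_bounded_linear:
  assumes "normed_space_over s" "normed_space_over t" "A \<in> continuous_operators UNIV s UNIV t"
  shows "bounded_linear A"
proof -
  interpret operator_spaces s t UNIV UNIV using assms(1,2) by (rule operator_spaces_UNIV)
  obtain K where "\<And>x. norm (A x) \<le> K * norm x" using operator_bounded[OF assms(3)] by (metis UNIV_I)
  moreover have "A (r *\<^sub>R x) = r *\<^sub>R A x" for r x
    using assms(3) by (simp add: continuous_operators_def flip: dom.scale_of_real cod.scale_of_real)
  ultimately show ?thesis
    using assms(3) by (intro bounded_linear_intro[of _ K]) (auto simp: continuous_operators_def mult.commute)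
qed

lemma adjoint_in_continuous_operators:
  assumes "normed_space_over s" "normed_space_over t" and A: "A \<in> continuous_operators UNIV s UNIV t"
  shows "adjoint_operator A \<in> continuous_operators (dual_space t) dual_scale (dual_space s) dual_scale"
proof -
  have bl: "bounded_linear A" using assms by (rule continuous_operators_bounded_linear)
  have eq: "adjoint_operator A = (\<lambda>f. f o\<^sub>L Blinfun A)"
    by (auto simp: fun_eq_iff adjoint_operator_apply[OF bl] bounded_linear_Blinfun_apply[OF bl] intro!: blinfun_eqI)
  have "continuous_on (dual_space t) (adjoint_operator A)"
    unfolding eq by (intro linear_continuous_on
        bounded_bilinear.bounded_linear_left[OF bounded_bilinear_blinfun_compose])
  then show ?thesis
    using A by (auto simp: continuous_operators_def dual_space_def adjoint_operator_apply[OF bl]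
        blinfun.add_left intro!: blinfun_eqI)
qed

text \<open>
  Independent functionals \<open>f\<^sub>1 \<circ> A, \<dots>, f\<^sub>m \<circ> A\<close> have biorthogonal vectors \<open>e\<^sub>1, \<dots>, e\<^sub>m\<close>. Then
  \<open>f\<^sub>i (A e\<^sub>j)\<close> is 1 for \<open>i = j\<close> and 0 otherwise, so the vectors \<open>A e\<^sub>1, \<dots>, A e\<^sub>m\<close> in the range of
  \<open>A\<close> are independent as well.
\<close>

lemma rank_adjoint_le:
  assumes "normed_space_over s" "normed_space_over t" and A: "A \<in> continuous_operators UNIV s UNIV t"
    and rank: "rank_at_most UNIV t n A"
  shows "rank_at_most (dual_space t) dual_scale n (adjoint_operator A)"
proof -
  interpret X: normed_space_over s by fact
  interpret Y: normed_space_over t by fact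
  interpret D: normed_space_over "dual_scale :: 'a \<Rightarrow> ('b \<Rightarrow>\<^sub>L 'a) \<Rightarrow> ('b \<Rightarrow>\<^sub>L 'a)"
    by (rule normed_space_over_dual_scale)
  have bl: "bounded_linear A" using assms(1-3) by (rule continuous_operators_bounded_linear)
  have "card H \<le> n" if H: "H \<subseteq> adjoint_operator A ` dual_space t" "finite H" "D.independent H" for H
  proof -
    have "H \<subseteq> dual_space s"
      using H(1) adjoint_in_continuous_operators[OF assms(1-3)] by (auto simp: continuous_operators_def)
    then obtain e where e: "\<And>g h. g \<in> H \<Longrightarrow> h \<in> H \<Longrightarrow> blinfun_apply g (e h) = (if g = h then 1 else 0)"
      using biorthogonal_vectors[OF assms(1) H(2) _ H(3)] by metis
    have "\<forall>h\<in>H. \<exists>f\<in>dual_space t. h = adjoint_operator A f" using H(1) by blast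
    then obtain f where f: "\<And>h. h \<in> H \<Longrightarrow> f h \<in> dual_space t"
      "\<And>h. h \<in> H \<Longrightarrow> h = adjoint_operator A (f h)" by metis
    have fA: "blinfun_apply (f g) (A (e h)) = (if g = h then 1 else 0)" if "g \<in> H" "h \<in> H" for g h
      using e[OF that] f(2)[OF that(1)] adjoint_operator_apply[OF bl, of "f g" "e h"] by simp
    have "inj_on (\<lambda>h. A (e h)) H"
      by (rule inj_onI) (metis fA zero_neq_one)
    then have card: "card ((\<lambda>h. A (e h)) ` H) = card H" by (rule card_image)
    have "Y.independent ((\<lambda>h. A (e h)) ` H)"
    proof
      assume "Y.dependent ((\<lambda>h. A (e h)) ` H)"
      then obtain h where h: "h \<in> H" "A (e h) \<in> Y.span ((\<lambda>h. A (e h)) ` H - {A (e h)})"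
        by (auto simp: Y.dependent_def)
      have "Y.span ((\<lambda>h. A (e h)) ` H - {A (e h)}) \<subseteq> {y. blinfun_apply (f h) y = 0}"
      proof (rule Y.span_minimal)
        show "(\<lambda>h. A (e h)) ` H - {A (e h)} \<subseteq> {y. blinfun_apply (f h) y = 0}"
          using fA h(1) by auto
        show "Y.subspace {y. blinfun_apply (f h) y = 0}"
          using f(1)[OF h(1)] by (auto simp: Y.subspace_def dual_space_def blinfun.add_right)
      qed
      then show False using h fA[OF h(1) h(1)] by auto
    qed
    moreover have "(\<lambda>h. A (e h)) ` H \<subseteq> range A" "finite ((\<lambda>h. A (e h)) ` H)" using H(2) by auto
    ultimately show ?thesis
      using rank card unfolding rank_at_most_iff[OF Y.vector_space_axioms] by metis
  qed
  then show ?thesis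
    unfolding rank_at_most_iff[OF normed_space_over_dual_scale[THEN normed_space_over.axioms(1)]] by blast
qed

text \<open>
  The adjoint of an approximant of \<open>T\<close> approximates the adjoint of \<open>T\<close> at least as well,
  because a functional of norm at most 1 does not increase the norm of \<open>(T - A) x\<close>.
\<close>

lemma approximation_number_adjoint_le:
  assumes "normed_space_over s" "normed_space_over t" and T: "T \<in> continuous_operators UNIV s UNIV t"
  shows "approximation_number (dual_space t) dual_scale (dual_space s) dual_scale n (adjoint_operator T)
    \<le> approximation_number UNIV s UNIV t n T"
proof -
  interpret operator_spaces s t UNIV UNIV using assms(1,2) by (rule operator_spaces_UNIV)
  interpret D: operator_spaces dual_scale dual_scale "dual_space t" "dual_space s"
    by (rule operator_spaces_dual)
  note adj = adjoint_in_continuous_operators[OF assms(1,2)]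
  note bl = continuous_operators_bounded_linear[OF assms(1,2)]
  show ?thesis
  proof (rule approximation_number_greatest)
    fix A assume A: "A \<in> operators" "rank_at_most UNIV t n A"
    let ?c = "operator_norm UNIV (\<lambda>x. T x - A x)"
    have "operator_norm (dual_space t) (\<lambda>f. adjoint_operator T f - adjoint_operator A f) \<le> ?c"
    proof (rule D.operator_norm_le)
      fix f assume f: "f \<in> dual_space t" "norm f \<le> 1"
      show "norm (adjoint_operator T f - adjoint_operator A f) \<le> ?c"
      proof (rule norm_blinfun_bound)
        show "0 \<le> ?c" by (rule operator_norm_nonneg[OF diff_operator[OF T A(1)]])
        fix x
        have "norm (blinfun_apply (adjoint_operator T f - adjoint_operator A f) x)
            = norm (blinfun_apply f (T x - A x))"
          by (simp add: blinfun.diff_left blinfun.diff_right adjoint_operator_apply bl T A(1))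
        also have "\<dots> \<le> norm f * norm (T x - A x)" by (rule norm_blinfun)
        also have "\<dots> \<le> 1 * norm (T x - A x)" using f(2) by (intro mult_right_mono) auto
        also have "\<dots> \<le> ?c * norm x"
          using norm_operator_le[OF diff_operator[OF T A(1)]] by simp
        finally show "norm (blinfun_apply (adjoint_operator T f - adjoint_operator A f) x) \<le> ?c * norm x" .
      qed
    qed
    with D.approximation_number_le[OF adj[OF T] adj[OF A(1)] rank_adjoint_le[OF assms(1,2) A]]
    show "approximation_number (dual_space t) dual_scale (dual_space s) dual_scale n (adjoint_operator T) \<le> ?c"
      by linarith
  qed
qed

section \<open>Finite nets for compact operators\<close>

text \<open>
  Total boundedness, stated by means of a finite-valued map: several such maps are combined by
  pairing them, whereas finite nets for several maps do not combine directly.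
\<close>

lemma finite_valued_approximation:
  fixes \<phi> :: "'x \<Rightarrow> 'm::metric_space"
  assumes "\<phi> ` D \<subseteq> K" "compact K" "0 < \<delta>"
  obtains \<kappa> where "finite (\<kappa> ` D)" "\<And>x. x \<in> D \<Longrightarrow> dist (\<kappa> x) (\<phi> x) < \<delta>"
proof -
  obtain C where C: "finite C" "K \<subseteq> (\<Union>y\<in>C. ball y \<delta>)"
    using assms(2,3) by (metis compact_eq_totally_bounded)
  have "\<exists>y. x \<in> D \<longrightarrow> y \<in> C \<and> dist y (\<phi> x) < \<delta>" for x
    using C(2) assms(1) by (fastforce simp: mem_ball)
  then obtain \<kappa> where \<kappa>: "\<And>x. x \<in> D \<Longrightarrow> \<kappa> x \<in> C \<and> dist (\<kappa> x) (\<phi> x) < \<delta>" by metis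
  then have "finite (\<kappa> ` D)" using C(1) by (meson finite_subset image_subsetI)
  then show thesis using \<kappa> that by blast
qed

text \<open>
  One net that serves \<open>T\<close> and finitely many functionals at the same time. Each of these maps has a
  finite-valued approximation on the unit ball; a point's label collects all the approximate values.
  There are finitely many labels, and one representative for each of them forms the net.
\<close>

lemma compact_operator_finite_net:
  fixes T :: "'a::real_normed_vector \<Rightarrow> 'b::real_normed_vector"
    and H :: "('a \<Rightarrow>\<^sub>L 'k::real_or_complex) set"
  assumes T: "compact_operator s t T" and H: "finite H" and "0 < \<delta>"
  obtains S where "finite S" "S \<subseteq> cball 0 1"
    "\<And>x. norm x \<le> 1 \<Longrightarrow> \<exists>y\<in>S. norm (T x - T y) < \<delta> \<and>
       (\<forall>h\<in>H. norm (blinfun_apply h x - blinfun_apply h y) < \<delta>)"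
proof -
  define B where "B = cball (0::'a) 1"
  have "compact (closure (T ` B))" using T by (simp add: compact_operator_def B_def)
  then obtain \<kappa> where \<kappa>: "finite (\<kappa> ` B)" "\<And>x. x \<in> B \<Longrightarrow> dist (\<kappa> x) (T x) < \<delta> / 2"
    using finite_valued_approximation[OF closure_subset, of T B "\<delta> / 2"] \<open>0 < \<delta>\<close> by (metis half_gt_zero)
  have "\<exists>\<mu>. finite (\<mu> ` B) \<and> (\<forall>x\<in>B. dist (\<mu> x) (blinfun_apply h x) < \<delta> / 2)" for h :: "'a \<Rightarrow>\<^sub>L 'k"
  proof -
    have "blinfun_apply h ` B \<subseteq> cball 0 (norm h)"
    proof
      fix z assume "z \<in> blinfun_apply h ` B"
      then obtain x where x: "norm x \<le> 1" "z = blinfun_apply h x" by (auto simp: B_def)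
      have "norm z \<le> norm h * norm x" unfolding x(2) by (rule norm_blinfun)
      also have "\<dots> \<le> norm h * 1" using x(1) by (intro mult_left_mono) auto
      finally show "z \<in> cball 0 (norm h)" by simp
    qed
    from finite_valued_approximation[OF this compact_cball_scalar, of "\<delta> / 2"] \<open>0 < \<delta>\<close>
    show ?thesis by (metis half_gt_zero)
  qed
  then have "\<forall>h::'a \<Rightarrow>\<^sub>L 'k. \<exists>\<mu>. finite (\<mu> ` B) \<and> (\<forall>x\<in>B. dist (\<mu> x) (blinfun_apply h x) < \<delta> / 2)"
    by blast
  then obtain \<mu> where "\<forall>h::'a \<Rightarrow>\<^sub>L 'k. finite (\<mu> h ` B) \<and> (\<forall>x\<in>B. dist (\<mu> h x) (blinfun_apply h x) < \<delta> / 2)"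
    using choice[of "\<lambda>h \<mu>. finite (\<mu> ` B) \<and> (\<forall>x\<in>B. dist (\<mu> x) (blinfun_apply h x) < \<delta> / 2)"] by blast
  then have \<mu>: "\<And>h. finite (\<mu> h ` B)" "\<And>h x. x \<in> B \<Longrightarrow> dist (\<mu> h x) (blinfun_apply h x) < \<delta> / 2"
    by blast+
  define label where "label x = (\<kappa> x, \<lambda>h\<in>H. \<mu> h x)" for x
  have "label ` B \<subseteq> \<kappa> ` B \<times> (\<Pi>\<^sub>E h\<in>H. \<mu> h ` B)" by (auto simp: label_def)
  moreover have "finite (\<kappa> ` B \<times> (\<Pi>\<^sub>E h\<in>H. \<mu> h ` B))"
    using \<kappa>(1) \<mu>(1) H by (intro finite_cartesian_product finite_PiE) auto
  ultimately have "finite (label ` B)" by (rule finite_subset)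
  then obtain S where S: "S \<subseteq> B" "finite S" "label ` B = label ` S"
    using finite_subset_image[of "label ` B" label B] by auto
  show thesis
  proof (rule that)
    show "finite S" "S \<subseteq> cball 0 1" using S by (simp_all add: B_def)
    fix x :: 'a assume "norm x \<le> 1"
    then have x: "x \<in> B" by (simp add: B_def)
    then obtain y where y: "y \<in> S" "label y = label x" using S(3) by (metis imageE imageI)
    then have yB: "y \<in> B" using S(1) by blast
    have "norm (T x - T y) < \<delta>"
      using \<kappa>(2)[OF x] \<kappa>(2)[OF yB] y(2) dist_triangle_half_r[of "\<kappa> x" "T x" \<delta> "T y"]
      by (simp add: label_def dist_norm)
    moreover have "norm (blinfun_apply h x - blinfun_apply h y) < \<delta>" if "h \<in> H" for h
    proof -
      have "\<mu> h x = \<mu> h y" using y(2) that by (auto simp: label_def fun_eq_iff restrict_def split: if_splits)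
      then show ?thesis
        using \<mu>(2)[OF x, of h] \<mu>(2)[OF yB, of h]
          dist_triangle_half_r[of "\<mu> h x" "blinfun_apply h x" \<delta> "blinfun_apply h y"]
        by (simp add: dist_norm)
    qed
    ultimately show "\<exists>y\<in>S. norm (T x - T y) < \<delta> \<and>
       (\<forall>h\<in>H. norm (blinfun_apply h x - blinfun_apply h y) < \<delta>)" using y(1) by blast
  qed
qed

section \<open>From the adjoint back to the operator\<close>

lemma norm_blinfun_le_on_ball:
  fixes k :: "'a::real_normed_vector \<Rightarrow>\<^sub>L 'b::real_normed_vector"
  assumes "0 \<le> r" "\<And>y. norm y \<le> 1 \<Longrightarrow> norm (blinfun_apply k y) \<le> r"
  shows "norm k \<le> r"
proof (rule norm_blinfun_bound[OF assms(1)])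
  fix y :: 'a
  show "norm (blinfun_apply k y) \<le> r * norm y"
  proof (cases "y = 0")
    case False
    then have "norm (blinfun_apply k (y /\<^sub>R norm y)) \<le> r" by (intro assms(2)) simp
    then show ?thesis using False by (simp add: blinfun.scaleR_right field_simps)
  qed (simp add: blinfun.zero_right)
qed

text \<open>
  The core of the proof. The operator \<open>B\<close> has the form \<open>B f = \<Sum>h. \<phi> h f * h\<close> with elements
  \<open>\<phi> h = (\<lambda>f. B f (e h))\<close> of the bidual of the target space. On finitely many points \<open>x\<close> of the unit
  ball, the \<open>\<phi> h\<close> can be replaced by vectors \<open>z h\<close> of the space itself: \<open>T x\<close> is then
  approximated by \<open>\<Sum>h. h x * z h\<close> almost as well as the adjoint of \<open>T\<close> is by \<open>B\<close>.
  
  Otherwise the tuple \<open>(T x)\<close> indexed by \<open>S\<close> has, in the maximum norm, distance at least \<open>c\<close> from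
  the subspace of all tuples \<open>(\<Sum>h. h x * z h)\<close>. By Hahn-Banach some functional of norm at most 1
  annihilates the subspace and is at least \<open>c\<close> on the tuple. Such a functional is a family
  \<open>(k x)\<close> in the dual space with \<open>\<Sum>x. norm (k x) \<le> 1\<close>. That it annihilates the subspace means
  \<open>\<Sum>x. h x * k x = 0\<close> for every \<open>h\<close>, whence \<open>\<Sum>x. B (k x) x = \<Sum>h. \<phi> h (\<Sum>x. h x * k x) = 0\<close>.
  So the value of the functional at \<open>(T x)\<close> is the real part of
  \<open>\<Sum>x. k x (T x) = \<Sum>x. (adjoint T (k x) - B (k x)) x\<close>, which is at most the norm of
  \<open>adjoint T - B\<close> and thus less than \<open>c\<close>.
\<close>

lemma finite_preadjoint_approximation:
  fixes s :: "'k::real_or_complex \<Rightarrow> 'a::real_normed_vector \<Rightarrow> 'a"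
    and t :: "'k \<Rightarrow> 'b::real_normed_vector \<Rightarrow> 'b"
  assumes ns: "normed_space_over s" "normed_space_over t"
    and T: "T \<in> continuous_operators UNIV s UNIV t"
    and B: "B \<in> continuous_operators (dual_space t) dual_scale (dual_space s) dual_scale"
    and BH: "\<And>f. f \<in> dual_space t \<Longrightarrow>
      B f = (\<Sum>h\<in>H. dual_scale (blinfun_apply (B f) (e h)) h)"
    and H: "finite H" "H \<subseteq> dual_space s"
    and S: "finite S" "S \<subseteq> cball 0 1"
    and c: "operator_norm (dual_space t) (\<lambda>f. adjoint_operator T f - B f) < c"
  obtains z where "\<And>x. x \<in> S \<Longrightarrow> norm (T x - (\<Sum>h\<in>H. t (blinfun_apply h x) (z h))) < c"
proof (rule ccontr)
  assume "\<not> thesis"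
  then have contra: "\<exists>x\<in>S. c \<le> norm (T x - (\<Sum>h\<in>H. t (blinfun_apply h x) (z h)))" for z
    using that by (meson not_le)
  then have "S \<noteq> {}" by blast
  interpret Y: normed_space_over t by fact
  interpret D: operator_spaces dual_scale dual_scale "dual_space t" "dual_space s"
    by (rule operator_spaces_dual)
  note bl = continuous_operators_bounded_linear[OF ns T]
  let ?c' = "operator_norm (dual_space t) (\<lambda>f. adjoint_operator T f - B f)"
  have diff: "(\<lambda>f. adjoint_operator T f - B f) \<in> D.operators"
    by (rule D.diff_operator[OF adjoint_in_continuous_operators[OF ns T] B])
  \<comment> \<open>Tuples indexed by \<open>S\<close> are represented by functions on the whole type; the values outside \<open>S\<close>
    do not affect the seminorm \<open>N\<close>, hence not the functional \<open>F\<close> either (\<open>F_eqI\<close> below).\<close>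
  define \<sigma> where "\<sigma> r u = (\<lambda>x. r *\<^sub>R u x)" for r :: real and u :: "'a \<Rightarrow> 'b"
  define N where "N u = Max ((\<lambda>x. norm (u x)) ` S)" for u :: "'a \<Rightarrow> 'b"
  define A where "A z = (\<lambda>x. \<Sum>h\<in>H. t (blinfun_apply h x) (z h))" for z :: "('a \<Rightarrow>\<^sub>L 'k) \<Rightarrow> 'b"
  have vs: "vector_space \<sigma>"
    by unfold_locales (auto simp: \<sigma>_def fun_eq_iff algebra_simps)
  interpret P: vector_space \<sigma> by (rule vs)
  have N_ge: "norm (u x) \<le> N u" if "x \<in> S" for u x
    using that S(1) by (simp add: N_def)
  have N_le: "N u \<le> r" if "\<And>x. x \<in> S \<Longrightarrow> norm (u x) \<le> r" for u r
    using that S(1) \<open>S \<noteq> {}\<close> by (simp add: N_def)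
  have N0: "0 \<le> N u" for u
    using \<open>S \<noteq> {}\<close> N_ge norm_ge_zero order_trans by (metis ex_in_conv)
  have sub: "sublinear \<sigma> N"
  proof (rule sublinearI[OF vs])
    show "N (u + v) \<le> N u + N v" for u v
    proof (rule N_le)
      fix x assume x: "x \<in> S"
      show "norm ((u + v) x) \<le> N u + N v"
        using norm_triangle_ineq[of "u x" "v x"] N_ge[OF x, of u] N_ge[OF x, of v] by simp
    qed
    show "N (\<sigma> r u) \<le> r * N u" if "0 < r" for r u
      using that N_ge by (intro N_le) (simp add: \<sigma>_def)
    have "N 0 \<le> 0" by (rule N_le) simp
    then show "N 0 = 0" using N0[of 0] by simp
  qed
  have subspace: "P.subspace (range A)"
    unfolding P.subspace_def
  proof (intro conjI ballI allI)
    have "0 = A (\<lambda>_. 0)" by (simp add: A_def fun_eq_iff)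
    then show "0 \<in> range A" by blast
    fix u assume "u \<in> range A"
    then obtain z where z: "u = A z" by blast
    have "\<sigma> r u = A (\<lambda>h. r *\<^sub>R z h)" for r
      by (simp add: z A_def \<sigma>_def fun_eq_iff Y.scale_sum_right mult.commute flip: Y.scale_of_real)
    then show "\<sigma> r u \<in> range A" for r by blast
    fix v assume "v \<in> range A"
    then obtain z' where z': "v = A z'" by blast
    have "u + v = A (\<lambda>h. z h + z' h)"
      by (simp add: z z' A_def fun_eq_iff Y.scale_right_distrib sum.distrib)
    then show "u + v \<in> range A" by blast
  qed
  have far: "c \<le> N (T - u)" if u: "u \<in> range A" for u
  proof -
    obtain z where z: "u = A z" using u by blast
    obtain x where x: "x \<in> S" "c \<le> norm ((T - u) x)" using contra[of z] by (auto simp: z A_def)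
    show ?thesis using x(2) N_ge[OF x(1), of "T - u"] by linarith
  qed
  obtain F where F: "Vector_Spaces.linear \<sigma> (*) F" "\<And>u. F u \<le> N u"
    and FA: "\<And>u. u \<in> range A \<Longrightarrow> F u = 0" and FT: "c \<le> F T"
  proof (rule hahn_banach_distance[OF vs sub _ subspace])
    show "0 \<le> N u" for u by (rule N0)
    show "c \<le> N (T - u)" if "u \<in> range A" for u using that by (rule far)
  qed (rule that)
  interpret F: Vector_Spaces.linear \<sigma> "(*)" F by (rule F(1))
  define f where "f x y = F (\<lambda>x'. if x' = x then y else 0)" for x y
  have F_eqI: "F u = F v" if "\<And>x. x \<in> S \<Longrightarrow> u x = v x" for u v
  proof -
    have "N (u - v) \<le> 0" "N (v - u) \<le> 0" using that by (auto intro!: N_le)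
    then show ?thesis using F(2)[of "u - v"] F(2)[of "v - u"] by (simp add: F.diff)
  qed
  have F_sum: "F u = (\<Sum>x\<in>S. f x (u x))" for u
  proof -
    have "F u = F (\<Sum>x\<in>S. (\<lambda>x'. if x' = x then u x else 0))"
    proof (rule F_eqI)
      fix x assume x: "x \<in> S"
      have "(\<Sum>x\<in>S. (\<lambda>x'. if x' = x then u x else 0)) x = (\<Sum>y\<in>S. if x = y then u y else 0)"
        by (induction S rule: infinite_finite_induct) auto
      then show "u x = (\<Sum>x\<in>S. (\<lambda>x'. if x' = x then u x else 0)) x" using x S(1) by simp
    qed
    then show ?thesis by (simp add: F.sum f_def)
  qed
  have f: "bounded_linear (f x)" if x: "x \<in> S" for x
  proof (rule bounded_linear_intro[of _ 1])
    show "f x (y + y') = f x y + f x y'" for y y'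
      unfolding f_def F.add[symmetric] by (rule arg_cong[of _ _ F]) (auto simp: fun_eq_iff)
    show scaleR: "f x (r *\<^sub>R y) = r *\<^sub>R f x y" for r y
      unfolding f_def real_scaleR_def F.scale[symmetric]
      by (rule arg_cong[of _ _ F]) (auto simp: fun_eq_iff \<sigma>_def)
    have le: "f x y \<le> norm y" for y
      unfolding f_def by (rule order_trans[OF F(2)], rule N_le) auto
    show "norm (f x y) \<le> norm y * 1" for y
      using le[of y] le[of "- y"] scaleR[of "-1" y] by simp
  qed
  obtain \<rho> :: "'k \<Rightarrow> real" where \<rho>: "linear \<rho>" "\<And>r. \<rho> (of_real r) = r" "\<And>z. \<bar>\<rho> z\<bar> \<le> norm z"
    and ex: "\<And>f. bounded_linear f \<Longrightarrow> \<exists>h\<in>dual_space t. \<forall>x. \<rho> (blinfun_apply h x) = f x"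
    using real_part_of_functionals[OF ns(2)] by metis
  obtain k where k: "\<And>x. x \<in> S \<Longrightarrow> k x \<in> dual_space t"
    "\<And>x y. x \<in> S \<Longrightarrow> \<rho> (blinfun_apply (k x) y) = f x y"
    using ex[OF f] by metis
  have k_scale: "blinfun_apply (k x) (t a y) = a * blinfun_apply (k x) y" if "x \<in> S" for x a y
    using k(1)[OF that] by (simp add: dual_space_def)
  \<comment> \<open>A scalar of modulus at most 1 turns \<open>v\<close> into its modulus, so that a bound on real parts
    becomes a bound on moduli.\<close>
  have rotate: "\<exists>a. norm a \<le> 1 \<and> \<rho> (a * v) = norm v" for v :: 'k
  proof (cases "v = 0")
    case True
    then show ?thesis using \<rho>(2)[of 0] by (intro exI[of _ 0]) simp
  next
    case False
    then show ?thesis using \<rho>(2)[of "norm v"]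
      by (intro exI[of _ "of_real (norm v) / v"]) (simp add: norm_divide)
  qed
  \<comment> \<open>The subspace is closed under multiplication by scalars, so not only the real part of the
    sum vanishes.\<close>
  have annihilates: "(\<Sum>x\<in>S. dual_scale (blinfun_apply h x) (k x)) = 0" if h: "h \<in> H" for h
  proof (rule blinfun_eqI)
    fix y
    let ?v = "\<Sum>x\<in>S. blinfun_apply h x * blinfun_apply (k x) y"
    obtain a where a: "\<rho> (a * ?v) = norm ?v" using rotate by blast
    have "a * ?v = (\<Sum>x\<in>S. blinfun_apply (k x) (t (blinfun_apply h x) (t a y)))"
      by (simp add: sum_distrib_left k_scale mult_ac)
    then have "\<rho> (a * ?v) = (\<Sum>x\<in>S. f x (t (blinfun_apply h x) (t a y)))"
      by (simp add: linear_sum[OF \<rho>(1)] k(2))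
    also have "\<dots> = F (\<lambda>x. t (blinfun_apply h x) (t a y))" by (rule F_sum[symmetric])
    also have "(\<lambda>x. t (blinfun_apply h x) (t a y)) = A (\<lambda>g. if g = h then t a y else 0)"
      using h H(1) by (simp add: A_def if_distrib[of "t _"] cong: if_cong)
    also have "F \<dots> = 0" by (rule FA) blast
    finally show "blinfun_apply (\<Sum>x\<in>S. dual_scale (blinfun_apply h x) (k x)) y = blinfun_apply 0 y"
      using a by (simp add: blinfun.sum_left)
  qed
  \<comment> \<open>The norms of the \<open>k x\<close> are attained only up to \<open>\<delta>\<close>; almost extremal vectors, rotated by
    scalars, form a tuple of norm at most 1 at which \<open>F\<close> is almost the sum of the norms.\<close>
  have norm_k: "(\<Sum>x\<in>S. norm (k x)) \<le> 1"
  proof (rule field_le_epsilon)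
    fix \<epsilon> :: real assume \<epsilon>: "0 < \<epsilon>"
    define \<delta> where "\<delta> = \<epsilon> / card S"
    have \<delta>: "0 < \<delta>" using \<epsilon> S(1) \<open>S \<noteq> {}\<close> by (simp add: \<delta>_def card_gt_0_iff)
    have "\<exists>y. norm y \<le> 1 \<and> norm (k x) - \<delta> \<le> norm (blinfun_apply (k x) y)" for x
    proof (rule ccontr)
      assume *: "\<not> ?thesis"
      then have "norm (blinfun_apply (k x) 0) < norm (k x) - \<delta>" by (metis norm_zero not_le zero_le_one)
      then have "0 \<le> norm (k x) - \<delta>" by simp
      moreover have "norm (blinfun_apply (k x) y) \<le> norm (k x) - \<delta>" if "norm y \<le> 1" for y
        using * that by (meson less_imp_le not_le)
      ultimately have "norm (k x) \<le> norm (k x) - \<delta>" by (rule norm_blinfun_le_on_ball)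
      then show False using \<delta> by simp
    qed
    then obtain y where y: "\<And>x. norm (y x) \<le> 1"
      "\<And>x. norm (k x) - \<delta> \<le> norm (blinfun_apply (k x) (y x))" by metis
    obtain b :: "'k \<Rightarrow> 'k" where b: "\<And>v. norm (b v) \<le> 1" "\<And>v. \<rho> (b v * v) = norm v"
      using rotate by metis
    define a where "a x = b (blinfun_apply (k x) (y x))" for x
    have a: "norm (a x) \<le> 1"
      "\<rho> (a x * blinfun_apply (k x) (y x)) = norm (blinfun_apply (k x) (y x))" for x
      by (simp_all add: a_def b)
    have "(\<Sum>x\<in>S. norm (k x)) - \<epsilon> = (\<Sum>x\<in>S. norm (k x) - \<delta>)"
      using S(1) \<open>S \<noteq> {}\<close> by (simp add: sum_subtractf \<delta>_def)
    also have "\<dots> \<le> (\<Sum>x\<in>S. norm (blinfun_apply (k x) (y x)))" by (intro sum_mono y(2))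
    also have "\<dots> = (\<Sum>x\<in>S. f x (t (a x) (y x)))"
      by (intro sum.cong refl) (simp add: k_scale a(2) flip: k(2))
    also have "\<dots> = F (\<lambda>x. t (a x) (y x))" by (rule F_sum[symmetric])
    also have "\<dots> \<le> N (\<lambda>x. t (a x) (y x))" by (rule F(2))
    also have "\<dots> \<le> 1"
      using a(1) y(1) by (intro N_le) (simp add: Y.norm_scale mult_le_one)
    finally show "(\<Sum>x\<in>S. norm (k x)) \<le> 1 + \<epsilon>" by simp
  qed
  have "(\<Sum>x\<in>S. blinfun_apply (B (k x)) x) = 0"
  proof -
    have "(\<Sum>x\<in>S. blinfun_apply (B (k x)) x)
        = (\<Sum>x\<in>S. \<Sum>h\<in>H. blinfun_apply h x * blinfun_apply (B (k x)) (e h))"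
    proof (intro sum.cong refl)
      fix x assume "x \<in> S"
      then have "blinfun_apply (B (k x)) x
          = blinfun_apply (\<Sum>h\<in>H. dual_scale (blinfun_apply (B (k x)) (e h)) h) x"
        using BH[OF k(1)] by simp
      then show "blinfun_apply (B (k x)) x = (\<Sum>h\<in>H. blinfun_apply h x * blinfun_apply (B (k x)) (e h))"
        by (simp add: blinfun.sum_left mult.commute)
    qed
    also have "\<dots> = (\<Sum>h\<in>H. \<Sum>x\<in>S. blinfun_apply h x * blinfun_apply (B (k x)) (e h))"
      by (rule sum.swap)
    also have "\<dots> = (\<Sum>h\<in>H. blinfun_apply (B (\<Sum>x\<in>S. dual_scale (blinfun_apply h x) (k x))) (e h))"
      using k(1) by (simp add: D.operator_sum[OF B] blinfun.sum_left)
    also have "\<dots> = 0" by (simp add: annihilates D.operator_0[OF B] blinfun.zero_left)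
    finally show ?thesis .
  qed
  then have "(\<Sum>x\<in>S. blinfun_apply (k x) (T x)) = (\<Sum>x\<in>S. blinfun_apply (adjoint_operator T (k x) - B (k x)) x)"
    by (simp add: adjoint_operator_apply[OF bl] blinfun.diff_left sum_subtractf)
  moreover have "F T = \<rho> (\<Sum>x\<in>S. blinfun_apply (k x) (T x))"
    by (simp add: F_sum linear_sum[OF \<rho>(1)] k(2))
  ultimately have "F T \<le> norm (\<Sum>x\<in>S. blinfun_apply (adjoint_operator T (k x) - B (k x)) x)"
    using \<rho>(3) abs_le_D1 by metis
  also have "\<dots> \<le> (\<Sum>x\<in>S. ?c' * norm (k x))"
  proof (rule sum_norm_le)
    fix x assume x: "x \<in> S"
    have "norm (blinfun_apply (adjoint_operator T (k x) - B (k x)) x)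
        \<le> norm (adjoint_operator T (k x) - B (k x)) * norm x" by (rule norm_blinfun)
    also have "\<dots> \<le> norm (adjoint_operator T (k x) - B (k x)) * 1"
      using x S(2) by (intro mult_left_mono) auto
    also have "\<dots> \<le> ?c' * norm (k x)" using D.norm_operator_le[OF diff k(1)[OF x]] by simp
    finally show "norm (blinfun_apply (adjoint_operator T (k x) - B (k x)) x) \<le> ?c' * norm (k x)" .
  qed
  also have "\<dots> = ?c' * (\<Sum>x\<in>S. norm (k x))" by (simp add: sum_distrib_left)
  also have "\<dots> \<le> ?c' * 1" by (intro mult_left_mono norm_k D.operator_norm_nonneg[OF diff])
  also have "\<dots> < c" using c by simp
  finally show False using FT by simp
qed

lemma finite_rank_operator:
  assumes "normed_space_over s" "normed_space_over t" "finite H" "H \<subseteq> dual_space s"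
  shows "(\<lambda>x. \<Sum>h\<in>H. t (blinfun_apply h x) (z h)) \<in> continuous_operators UNIV s UNIV t"
    and "rank_at_most UNIV t (card H) (\<lambda>x. \<Sum>h\<in>H. t (blinfun_apply h x) (z h))"
proof -
  interpret X: normed_space_over s by fact
  interpret Y: normed_space_over t by fact
  let ?A = "\<lambda>x. \<Sum>h\<in>H. t (blinfun_apply h x) (z h)"
  have t: "bounded_linear (\<lambda>c. t c y)" for y
    by (rule bounded_linear_intro[of _ "norm y"])
      (auto simp: Y.scale_left_distrib Y.norm_scale scaleR_conv_of_real simp flip: Y.scale_of_real)
  have "continuous_on UNIV ?A"
    by (intro continuous_on_sum bounded_linear.continuous_on[OF t] linear_continuous_on
        blinfun.bounded_linear_right)
  moreover have "?A (s c x) = t c (?A x)" for c x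
    using assms(4) by (auto simp: dual_space_def Y.scale_sum_right intro!: sum.cong)
  ultimately show "?A \<in> continuous_operators UNIV s UNIV t"
    by (simp add: continuous_operators_def blinfun.add_right Y.scale_left_distrib sum.distrib)
  have span: "range ?A \<subseteq> Y.span (z ` H)"
    by (intro image_subsetI Y.span_sum Y.span_scale Y.span_base imageI)
  moreover have "Y.dim (range ?A) \<le> card H"
    using Y.dim_le_card[OF span] card_image_le[OF assms(3), of z] assms(3) by simp
  ultimately show "rank_at_most UNIV t (card H) ?A"
    unfolding rank_at_most_def using assms(3) by blast
qed

lemma rank_at_most_mono: "rank_at_most V t m A \<Longrightarrow> m \<le> n \<Longrightarrow> rank_at_most V t n A"
  by (auto simp: rank_at_most_def)

text \<open>
  Evaluating at biorthogonal vectors reads off the coefficients of \<open>B f\<close> in a basis \<open>H\<close> of the range.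
  In this form it is evident that they depend linearly on \<open>f\<close>.
\<close>

lemma finite_rank_dual_expansion:
  assumes ns: "normed_space_over s"
    and B: "B ` V \<subseteq> dual_space s" "rank_at_most V dual_scale n B"
  obtains H e where "finite H" "card H \<le> n" "H \<subseteq> dual_space s" "\<And>h. h \<in> H \<Longrightarrow> e h \<noteq> 0"
    "\<And>g h. g \<in> H \<Longrightarrow> h \<in> H \<Longrightarrow> blinfun_apply g (e h) = (if g = h then 1 else 0)"
    "\<And>f. f \<in> V \<Longrightarrow> B f = (\<Sum>h\<in>H. dual_scale (blinfun_apply (B f) (e h)) h)"
proof -
  interpret D: normed_space_over dual_scale by (rule normed_space_over_dual_scale)
  obtain H where H: "H \<subseteq> B ` V" "D.independent H" "B ` V \<subseteq> D.span H" "card H = D.dim (B ` V)"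
    by (rule D.basis_exists)
  obtain H0 where "finite H0" "B ` V \<subseteq> D.span H0" using B(2) by (auto simp: rank_at_most_def)
  then have fin: "finite H" using D.independent_span_bound[OF _ H(2)] H(1) by blast
  have Hd: "H \<subseteq> dual_space s" using H(1) B(1) by blast
  obtain e where e: "\<And>g h. g \<in> H \<Longrightarrow> h \<in> H \<Longrightarrow> blinfun_apply g (e h) = (if g = h then 1 else 0)"
    using biorthogonal_vectors[OF ns fin Hd H(2)] by metis
  show thesis
  proof (rule that[OF fin _ Hd])
    show "card H \<le> n" using H(4) B(2) by (simp add: rank_at_most_def)
    show "e h \<noteq> 0" if "h \<in> H" for h using e[OF that that] by (auto simp: blinfun.zero_right)
    fix f assume "f \<in> V"
    then have "B f \<in> D.span H" using H(3) by blast
    then obtain a where a: "B f = (\<Sum>h\<in>H. dual_scale (a h) h)"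
      unfolding D.span_finite[OF fin] by blast
    have "blinfun_apply (B f) (e h) = a h" if "h \<in> H" for h
      using that fin by (simp add: a blinfun.sum_left e if_distrib cong: if_cong)
    then show "B f = (\<Sum>h\<in>H. dual_scale (blinfun_apply (B f) (e h)) h)" using a by simp
  qed (use e in auto)
qed

text \<open>
  The vectors \<open>z h\<close> of the preceding approximation come without any bound, yet the error at a
  point near the net grows with their norms. The normalised vectors \<open>e h\<close> are therefore added to
  the net: at \<open>e h\<close> the approximant takes the value \<open>z h\<close>, so closeness to \<open>T\<close> there bounds \<open>z h\<close>
  independently of the rest of the net, whose mesh \<open>\<delta>\<close> can be chosen according to this bound.
\<close>

lemma approximation_number_le_adjoint:
  fixes s :: "'k::real_or_complex \<Rightarrow> 'a::real_normed_vector \<Rightarrow> 'a"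
    and t :: "'k \<Rightarrow> 'b::real_normed_vector \<Rightarrow> 'b"
  assumes ns: "normed_space_over s" "normed_space_over t"
    and T: "T \<in> continuous_operators UNIV s UNIV t" "compact_operator s t T"
  shows "approximation_number UNIV s UNIV t n T
    \<le> approximation_number (dual_space t) dual_scale (dual_space s) dual_scale n (adjoint_operator T)"
proof -
  interpret operator_spaces s t UNIV UNIV using ns by (rule operator_spaces_UNIV)
  interpret D: operator_spaces dual_scale dual_scale "dual_space t" "dual_space s"
    by (rule operator_spaces_dual)
  show ?thesis
  proof (rule D.approximation_number_greatest)
    fix B assume B: "B \<in> D.operators" "rank_at_most (dual_space t) dual_scale n B"
    let ?c = "operator_norm (dual_space t) (\<lambda>f. adjoint_operator T f - B f)"
    have im: "B ` dual_space t \<subseteq> dual_space s" using B(1) by (auto simp: continuous_operators_def)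
    obtain H e where H: "finite H" "card H \<le> n" "H \<subseteq> dual_space s" "\<And>h. h \<in> H \<Longrightarrow> e h \<noteq> 0"
      and e: "\<And>g h. g \<in> H \<Longrightarrow> h \<in> H \<Longrightarrow> blinfun_apply g (e h) = (if g = h then 1 else 0)"
      and BH: "\<And>f. f \<in> dual_space t \<Longrightarrow> B f = (\<Sum>h\<in>H. dual_scale (blinfun_apply (B f) (e h)) h)"
      by (rule finite_rank_dual_expansion[OF ns(1) im B(2)]) (rule that)
    show "approximation_number UNIV s UNIV t n T \<le> ?c"
    proof (rule field_le_epsilon)
      fix \<epsilon> :: real assume \<epsilon>: "0 < \<epsilon>"
      \<comment> \<open>Half of \<open>\<epsilon>\<close> is spent at the net points, the other half on \<open>\<delta> + \<delta> * M\<close> for moving from \<open>x\<close>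
        to a net point, first under \<open>T\<close> and then under the approximant.\<close>
      define c where "c = ?c + \<epsilon> / 2"
      define M where "M = (\<Sum>h\<in>H. norm (T (e h)) + c * norm (e h))"
      define \<delta> where "\<delta> = \<epsilon> / (2 * (1 + M))"
      have "0 \<le> ?c"
        by (rule D.operator_norm_nonneg[OF D.diff_operator[OF adjoint_in_continuous_operators[OF ns T(1)] B(1)]])
      then have c: "?c < c" "0 \<le> c" using \<epsilon> by (simp_all add: c_def)
      then have M: "0 \<le> M" by (simp add: M_def sum_nonneg)
      then have \<delta>: "0 < \<delta>" "\<delta> * (1 + M) = \<epsilon> / 2" using \<epsilon> by (simp_all add: \<delta>_def field_simps)
      obtain S where S: "finite S" "S \<subseteq> cball 0 1"
        and net: "\<And>x. norm x \<le> 1 \<Longrightarrow> \<exists>y\<in>S. norm (T x - T y) < \<delta> \<and>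
          (\<forall>h\<in>H. norm (blinfun_apply h x - blinfun_apply h y) < \<delta>)"
        using compact_operator_finite_net[OF T(2) H(1) \<delta>(1)] by metis
      let ?S = "S \<union> (\<lambda>h. e h /\<^sub>R norm (e h)) ` H"
      have "finite ?S" "?S \<subseteq> cball 0 1" using S H(1,4) by auto
      then obtain z where z: "\<And>x. x \<in> ?S \<Longrightarrow> norm (T x - (\<Sum>h\<in>H. t (blinfun_apply h x) (z h))) < c"
        using finite_preadjoint_approximation[OF ns T(1) B(1) BH H(1,3) _ _ c(1)] by metis
      let ?A = "\<lambda>x. \<Sum>h\<in>H. t (blinfun_apply h x) (z h)"
      note A = finite_rank_operator[OF ns H(1,3), of z]
      interpret T: bounded_linear T by (rule continuous_operators_bounded_linear[OF ns T(1)])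
      interpret A: bounded_linear ?A by (rule continuous_operators_bounded_linear[OF ns A(1)])
      have zM: "norm (z h) \<le> norm (T (e h)) + c * norm (e h)" if h: "h \<in> H" for h
      proof -
        have "?A (e h) = (\<Sum>g\<in>H. if g = h then z h else 0)"
          using e h by (intro sum.cong) auto
        then have Ae: "?A (e h) = z h" using h H(1) by simp
        have "norm (T (e h /\<^sub>R norm (e h)) - ?A (e h /\<^sub>R norm (e h))) < c" using h by (intro z) blast
        also have "T (e h /\<^sub>R norm (e h)) - ?A (e h /\<^sub>R norm (e h)) = (T (e h) - z h) /\<^sub>R norm (e h)"
          unfolding T.scaleR A.scaleR Ae by (simp add: scaleR_right_diff_distrib)
        also have "norm \<dots> = norm (T (e h) - z h) / norm (e h)"
          by (simp add: divide_inverse mult.commute)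
        finally have "norm (T (e h) - z h) \<le> c * norm (e h)"
          using H(4)[OF h] by (simp add: pos_divide_less_eq)
        then show ?thesis using norm_triangle_ineq2[of "z h" "T (e h)"] by (simp add: norm_minus_commute)
      qed
      have "operator_norm UNIV (\<lambda>x. T x - ?A x) \<le> ?c + \<epsilon>"
      proof (rule operator_norm_le)
        fix x :: 'a assume "norm x \<le> 1"
        then obtain y where y: "y \<in> S" "norm (T x - T y) < \<delta>"
          "\<And>h. h \<in> H \<Longrightarrow> norm (blinfun_apply h x - blinfun_apply h y) < \<delta>" using net by blast
        have "norm (?A y - ?A x) \<le> (\<Sum>h\<in>H. \<delta> * (norm (T (e h)) + c * norm (e h)))"
          unfolding sum_subtractf[symmetric]
        proof (rule sum_norm_le)
          fix h assume h: "h \<in> H"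
          have "norm (t (blinfun_apply h y) (z h) - t (blinfun_apply h x) (z h))
              = norm (blinfun_apply h x - blinfun_apply h y) * norm (z h)"
            unfolding cod.scale_left_diff_distrib[symmetric] cod.norm_scale
            by (simp add: norm_minus_commute)
          also have "\<dots> \<le> \<delta> * (norm (T (e h)) + c * norm (e h))"
            using y(3)[OF h] zM[OF h] \<delta>(1) by (intro mult_mono) auto
          finally show "norm (t (blinfun_apply h y) (z h) - t (blinfun_apply h x) (z h))
              \<le> \<delta> * (norm (T (e h)) + c * norm (e h))" .
        qed
        also have "\<dots> = \<delta> * M" by (simp add: M_def sum_distrib_left)
        finally have "norm (?A y - ?A x) \<le> \<delta> * M" .
        moreover have "norm (T y - ?A y) < c" using y(1) by (intro z) blast
        moreover have "norm (T x - ?A x) \<le> norm (T x - T y) + norm (T y - ?A y) + norm (?A y - ?A x)"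
        proof -
          have eq: "T x - ?A x = ((T x - T y) + (T y - ?A y)) + (?A y - ?A x)" by simp
          show ?thesis
            unfolding eq
            using norm_triangle_ineq[of "T x - T y" "T y - ?A y"]
              norm_triangle_ineq[of "(T x - T y) + (T y - ?A y)" "?A y - ?A x"]
            by linarith
        qed
        ultimately show "norm (T x - ?A x) \<le> ?c + \<epsilon>"
          using y(2) \<delta>(2) by (simp add: c_def algebra_simps)
      qed
      with approximation_number_le[OF T(1) A(1) rank_at_most_mono[OF A(2) H(2)]]
      show "approximation_number UNIV s UNIV t n T \<le> ?c + \<epsilon>" by linarith
    qed
  qed
qed

lemma approximation_number_adjoint:
  assumes ns: "normed_space_over s" "normed_space_over t" and T: "compact_operator s t T"
  shows "approximation_number UNIV s UNIV t n T
    = approximation_number (dual_space t) dual_scale (dual_space s) dual_scale n (adjoint_operator T)"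
proof (rule antisym)
  have "bounded_linear T" using ns T by (rule compact_operator_bounded_linear)
  then have cont: "T \<in> continuous_operators UNIV s UNIV t"
    using T by (simp add: continuous_operators_def compact_operator_def Vector_Spaces.linear_iff
        linear_continuous_on)
  from approximation_number_le_adjoint[OF ns cont T]
  show "approximation_number UNIV s UNIV t n T
    \<le> approximation_number (dual_space t) dual_scale (dual_space s) dual_scale n (adjoint_operator T)" .
  from approximation_number_adjoint_le[OF ns cont]
  show "approximation_number (dual_space t) dual_scale (dual_space s) dual_scale n (adjoint_operator T)
    \<le> approximation_number UNIV s UNIV t n T" .
qed

theorem theorem2p3:
  fixes scale :: "'k::real_or_complex \<Rightarrow> 'a::banach \<Rightarrow> 'a"
    and T :: "'a \<Rightarrow> 'a"
  assumes "normed_space_over scale"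
    and "compact_operator scale scale T"
  shows "\<forall>n. approximation_number UNIV scale UNIV scale n T =
             approximation_number (dual_space scale) dual_scale (dual_space scale) dual_scale n
               (adjoint_operator T)"
  using approximation_number_adjoint[OF assms(1,1,2)] by blast

end
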